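(* Let $\{c(\beta):\beta\in\mathbb{Q}/\mathbb{Z}\}$ be real numbers. For each positive integer $Q$ let $$T_Q(x)=\sum_{h(\beta)\le Q}c(\beta)f_\beta(x).$$ Suppose the sequence $\int_{\mathbb{R}/\mathbb{Z}}|T_Q(x)|\,dx$, $Q=1,2,\dots$, is bounded. Then there is a function $F$ with $\|F\|_1<\infty$ such that, for almost all irrational points $\alpha\in\mathbb{R}/\mathbb{Z}$, the limit $$\lim_{N\to\infty}\sum_{n=1}^N(-1)^{n-1}q_{n-1}(\alpha)\sum_{\beta\in E_n(\alpha)}c(\beta)=F(\alpha)$$ exists.
   Context: Every $\beta\in\mathbb{Q}/\mathbb{Z}$ can be written $\beta=a/q$ with $q\ge1$ and $\gcd(a,q)=1$; its height is $h(\beta)=q$. Put $\mathcal{F}_Q=\{\beta:h(\beta)\le Q\}$. For distinct $a,b\in\mathbb{R}/\mathbb{Z}$, $I(a,b)$ is the open arc from $a$ to $b$ in the positive direction, i.e. $\{a+t\bmod1:0<t<d\}$ with $d\in(0,1)$, $d\equiv b-a\pmod1$. For $\beta\ne0$ with $h(\beta)=Q$: $\beta'$ is the unique point of $\mathcal{F}_Q$ with $I(\beta',\beta)\cap\mathcal{F}_Q=\emptyset$, and $\beta''$ is the unique point of $\mathcal{F}_Q$ with $I(\beta,\beta'')\cap\mathcal{F}_Q=\emptyset$. Let $\psi(x)=x-[x]-\frac12$ for $x\notin\mathbb{Z}$ and $\psi(x)=0$ for $x\in\mathbb{Z}$. Define $f_0\equiv1$ and, for $\beta\ne0$, $f_\beta(x)=h(\beta)\psi(x-\beta)-h(\beta')\psi(x-\beta')-h(\beta'')\psi(x-\beta'')$.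 Identify an irrational $\alpha$ with its representative in $(0,1)$ and write $\alpha=[0;a_1,a_2,\dots]$. Set $p_{-2}=0$, $q_{-2}=1$, $p_{-1}=1$, $q_{-1}=0$, and for $n\ge0$ set $p_n=a_np_{n-1}+p_{n-2}$ and $q_n=a_nq_{n-1}+q_{n-2}$, with $a_0=0$. For $n\ge1$, $E_n(\alpha)=\{(mp_{n-1}+p_{n-2})/(mq_{n-1}+q_{n-2}):1\le m\le a_n\}\subset\mathbb{Q}/\mathbb{Z}$. *)

theory Defs
  imports "HOL-Analysis.Analysis"
begin

text \<open>Points of \<open>\<rat>/\<int>\<close> and \<open>\<real>/\<int>\<close> are represented by their representatives in \<open>[0,1)\<close>;
  reduction modulo 1 is \<^const>\<open>frac\<close>.\<close>

definition height :: "rat \<Rightarrow> nat" where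
  "height \<beta> = nat (snd (quotient_of \<beta>))"

definition farey :: "nat \<Rightarrow> rat set" where
  "farey Q = {\<beta> \<in> {0..<1}. height \<beta> \<le> Q}"

text \<open>Meaningful for \<open>a\<close>, \<open>b\<close> distinct modulo 1; then \<open>frac (b - a)\<close> is the \<open>d \<in> (0,1)\<close> with
  \<open>d \<equiv> b - a\<close> modulo 1.\<close>

definition arc_between :: "real \<Rightarrow> real \<Rightarrow> real set" where
  "arc_between a b = {frac (a + t) | t. 0 < t \<and> t < frac (b - a)}"

definition left_nbr :: "rat \<Rightarrow> rat" where
  "left_nbr \<beta> = (THE \<gamma>. \<gamma> \<in> farey (height \<beta>) \<and> \<gamma> \<noteq> \<beta> \<and>
     arc_between (of_rat \<gamma>) (of_rat \<beta>) \<inter> of_rat ` farey (height \<beta>) = {})"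

definition right_nbr :: "rat \<Rightarrow> rat" where
  "right_nbr \<beta> = (THE \<gamma>. \<gamma> \<in> farey (height \<beta>) \<and> \<gamma> \<noteq> \<beta> \<and>
     arc_between (of_rat \<beta>) (of_rat \<gamma>) \<inter> of_rat ` farey (height \<beta>) = {})"

definition sawtooth :: "real \<Rightarrow> real" where
  "sawtooth x = (if x \<in> \<int> then 0 else x - of_int \<lfloor>x\<rfloor> - 1 / 2)"

definition farey_fun :: "rat \<Rightarrow> real \<Rightarrow> real" where
  "farey_fun \<beta> x = (if \<beta> = 0 then 1 else
     real (height \<beta>) * sawtooth (x - of_rat \<beta>)
     - real (height (left_nbr \<beta>)) * sawtooth (x - of_rat (left_nbr \<beta>))
     - real (height (right_nbr \<beta>)) * sawtooth (x - of_rat (right_nbr \<beta>)))"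

definition farey_sum :: "(rat \<Rightarrow> real) \<Rightarrow> nat \<Rightarrow> real \<Rightarrow> real" where
  "farey_sum c Q x = (\<Sum>\<beta>\<in>farey Q. c \<beta> * farey_fun \<beta> x)"

text \<open>Complete quotients and partial quotients of the continued fraction of \<open>\<alpha>\<close>;
  for \<open>\<alpha> \<in> (0,1)\<close> the zeroth partial quotient is 0.\<close>

primrec cf_complete :: "real \<Rightarrow> nat \<Rightarrow> real" where
  "cf_complete \<alpha> 0 = \<alpha>"
| "cf_complete \<alpha> (Suc n) = 1 / frac (cf_complete \<alpha> n)"

definition cf_digit :: "real \<Rightarrow> nat \<Rightarrow> int" where
  "cf_digit \<alpha> n = \<lfloor>cf_complete \<alpha> n\<rfloor>"

text \<open>The index is shifted by 2: \<open>cf_num_shift \<alpha> k\<close> is \<open>p\<^bsub>k-2\<^esub>\<close> and \<open>cf_den_shift \<alpha> k\<close> is \<open>q\<^bsub>k-2\<^esub>\<close>.\<close>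

fun cf_num_shift :: "real \<Rightarrow> nat \<Rightarrow> int" where
  "cf_num_shift \<alpha> 0 = 0"
| "cf_num_shift \<alpha> (Suc 0) = 1"
| "cf_num_shift \<alpha> (Suc (Suc n)) = cf_digit \<alpha> n * cf_num_shift \<alpha> (Suc n) + cf_num_shift \<alpha> n"

fun cf_den_shift :: "real \<Rightarrow> nat \<Rightarrow> int" where
  "cf_den_shift \<alpha> 0 = 1"
| "cf_den_shift \<alpha> (Suc 0) = 0"
| "cf_den_shift \<alpha> (Suc (Suc n)) = cf_digit \<alpha> n * cf_den_shift \<alpha> (Suc n) + cf_den_shift \<alpha> n"

text \<open>\<open>p\<^sub>n\<close> and \<open>q\<^sub>n\<close> for integers \<open>n \<ge> -2\<close>.\<close>

definition cf_num :: "real \<Rightarrow> int \<Rightarrow> int" where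
  "cf_num \<alpha> n = cf_num_shift \<alpha> (nat (n + 2))"

definition cf_den :: "real \<Rightarrow> int \<Rightarrow> int" where
  "cf_den \<alpha> n = cf_den_shift \<alpha> (nat (n + 2))"

definition semiconvergents :: "real \<Rightarrow> nat \<Rightarrow> rat set" where
  "semiconvergents \<alpha> n =
     {frac (of_int (m * cf_num \<alpha> (int n - 1) + cf_num \<alpha> (int n - 2)) /
            of_int (m * cf_den \<alpha> (int n - 1) + cf_den \<alpha> (int n - 2))) | m.
      1 \<le> m \<and> m \<le> cf_digit \<alpha> n}"

end

theory Submission
  imports Defs
begin

text \<open>A fraction \<open>\<beta> \<noteq> 0\<close> of height \<open>Q\<close> is the mediant of its neighbours \<open>p/q\<close> and \<open>r/s\<close>, so
  \<open>f\<^sub>\<beta>\<close> equals \<open>q\<close> on \<open>(p/q, \<beta>)\<close>, \<open>-s\<close> on \<open>(\<beta>, r/s)\<close> and vanishes elsewhere. It has mean zero, and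
  every \<open>f\<^sub>\<gamma>\<close> with \<open>\<gamma>\<close> of height less than \<open>Q\<close> is constant on its support. Hence \<open>T\<^sub>1, T\<^sub>2, \<dots>\<close> is an
  \<open>L\<^sup>1\<close>-bounded martingale, which converges almost everywhere to an integrable function by Doob's upcrossing
  argument and Fatou's lemma. The \<open>\<beta>\<close> with \<open>f\<^sub>\<beta>(\<alpha>) \<noteq> 0\<close> are met by following the mediants
  around \<open>\<alpha>\<close>, that is, they are the elements of \<open>E\<^sub>1(\<alpha>), E\<^sub>2(\<alpha>), \<dots>\<close> in order of height, with
  \<open>f\<^sub>\<beta>(\<alpha>) = (-1)\<^bsup>n-1\<^esup> q\<^bsub>n-1\<^esub>\<close> on \<open>E\<^sub>n(\<alpha>)\<close>. So the \<open>N\<close>-th partial sum is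
  \<open>T\<^sub>Q(\<alpha>)\<close> for \<open>Q = q\<^sub>N(\<alpha>)\<close>.\<close>

section \<open>Almost everywhere convergence of martingales\<close>

text \<open>Doob's betting strategy: buy at a value at most \<open>a\<close>, sell at a value at least \<open>b\<close>.
  \<open>holding a b x n\<close> is the position between times \<open>n\<close> and \<open>n + 1\<close>.\<close>

primrec holding :: "real \<Rightarrow> real \<Rightarrow> (nat \<Rightarrow> real) \<Rightarrow> nat \<Rightarrow> bool" where
  "holding a b x 0 = (x 0 \<le> a)"
| "holding a b x (Suc n) = (if holding a b x n then x (Suc n) < b else x (Suc n) \<le> a)"

primrec upcrossings :: "real \<Rightarrow> real \<Rightarrow> (nat \<Rightarrow> real) \<Rightarrow> nat \<Rightarrow> nat" where
  "upcrossings a b x 0 = 0"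
| "upcrossings a b x (Suc n) = upcrossings a b x n + of_bool (holding a b x n \<and> b \<le> x (Suc n))"

text \<open>The position at time \<open>n\<close> uses no later value, so holding is an event to
  which the martingale hypothesis applies.\<close>

lemma holding_cong: "(\<And>i. i \<le> n \<Longrightarrow> x i = y i) \<Longrightarrow> holding a b x n = holding a b y n"
  by (induction n) auto

lemma upcrossings_mono: "m \<le> n \<Longrightarrow> upcrossings a b x m \<le> upcrossings a b x n"
  by (induction n rule: dec_induct) auto

text \<open>Each completed upcrossing earns at least \<open>b - a\<close>. The term for an open
  position keeps the induction going: bought at a value at most \<open>a\<close>, it has so far
  gained at least \<open>x n - a\<close>.\<close>

lemma upcrossings_le_gain_aux:
  "(b - a) * real (upcrossings a b x n) + (if holding a b x n then x n - a else 0)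
     \<le> (\<Sum>k<n. of_bool (holding a b x k) * (x (Suc k) - x k))"
  by (induction n) (auto simp: algebra_simps)

lemma upcrossings_le_gain:
  "(b - a) * real (upcrossings a b x n)
     \<le> (\<Sum>k<n. of_bool (holding a b x k) * (x (Suc k) - x k)) + \<bar>x n\<bar> + \<bar>a\<bar>"
  using upcrossings_le_gain_aux[of b a x n] by (auto split: if_splits)

text \<open>After any time, a value at most \<open>a\<close> followed by the first later value at
  least \<open>b\<close> adds one more crossing.\<close>

lemma upcrossings_unbounded:
  assumes "a < b" and low: "\<exists>\<^sub>F n in sequentially. x n \<le> a" and high: "\<exists>\<^sub>F n in sequentially. b \<le> x n"
  shows "\<exists>n. B \<le> upcrossings a b x n"
proof (induction B)
  case (Suc B)
  then obtain n0 where n0: "B \<le> upcrossings a b x n0" by blast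
  obtain n1 where n1: "n1 \<ge> n0" "x n1 \<le> a"
    using low unfolding frequently_sequentially by blast
  have "\<exists>n2. n2 \<ge> n1 \<and> b \<le> x n2"
    using high unfolding frequently_sequentially by blast
  \<comment> \<open>At the first such time: all values from \<open>n1\<close> up to it stay below
    \<open>b\<close>, so nothing is sold in between.\<close>
  define n2 where "n2 = (LEAST n. n \<ge> n1 \<and> b \<le> x n)"
  have n2: "n2 \<ge> n1" "b \<le> x n2"
    using LeastI_ex[OF \<open>\<exists>n2. n2 \<ge> n1 \<and> b \<le> x n2\<close>] unfolding n2_def by auto
  have least: "x n < b" if "n1 \<le> n" "n < n2" for n
    using not_less_Least[of n "\<lambda>n. n \<ge> n1 \<and> b \<le> x n"] that unfolding n2_def by auto
  have "n1 \<noteq> n2" using n1 n2 \<open>a < b\<close> by auto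
  with n2 obtain m where m: "n2 = Suc m" "n1 \<le> m" by (cases n2) auto
  have hold: "holding a b x n" if "n1 \<le> n" "n \<le> m" for n
    using that
  proof (induction n rule: dec_induct)
    case base
    \<comment> \<open>A value at most \<open>a < b\<close> leads to holding whether or not the
      position was already open.\<close>
    then show ?case using n1 \<open>a < b\<close> by (cases n1) auto
  next
    case (step n)
    then show ?case using least[of "Suc n"] m by auto
  qed
  have "B \<le> upcrossings a b x m"
    using n0 upcrossings_mono[of n0 m a b x] n1 m by simp
  then have "Suc B \<le> upcrossings a b x n2" using hold[of m] m n2 by simp
  then show ?case by blast
qed simp

text \<open>Finitely many crossings exclude oscillation, and the frequent bound excludes escape to
  infinity. Rational levels suffice; there are countably many, so their exceptional null sets can be
  united later.\<close>

lemma convergent_if_upcrossings_bounded: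
  fixes x :: "nat \<Rightarrow> real"
  assumes up: "\<And>a b. a \<in> \<rat> \<Longrightarrow> b \<in> \<rat> \<Longrightarrow> a < b \<Longrightarrow> \<exists>B. \<forall>n. upcrossings a b x n < B"
    and freq: "\<exists>\<^sub>F n in sequentially. \<bar>x n\<bar> \<le> C"
  shows "convergent x"
proof -
  have no_osc: False
    if "a < b" and low: "\<exists>\<^sub>F n in sequentially. x n \<le> a"
      and high: "\<exists>\<^sub>F n in sequentially. b \<le> x n" for a b
  proof -
    obtain a' where a': "a' \<in> \<rat>" "a < a'" "a' < b" using Rats_dense_in_real[OF \<open>a < b\<close>] by blast
    obtain b' where b': "b' \<in> \<rat>" "a' < b'" "b' < b" using Rats_dense_in_real[OF a'(3)] by blast
    have "\<exists>\<^sub>F n in sequentially. x n \<le> a'" "\<exists>\<^sub>F n in sequentially. b' \<le> x n"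
      using frequently_elim1[OF low, of "\<lambda>n. x n \<le> a'"] frequently_elim1[OF high, of "\<lambda>n. b' \<le> x n"] a' b'
      by auto
    then show False
      using up[of a' b'] upcrossings_unbounded[of a' b' x] a' b' by (metis not_less)
  qed
  \<comment> \<open>Values at most \<open>C\<close> recur, so reaching \<open>C + 1\<close>
    infinitely often would be an oscillation between \<open>C\<close> and
    \<open>C + 1\<close>.\<close>
  have "\<not> (\<exists>\<^sub>F n in sequentially. C + 1 \<le> x n)"
    using no_osc[of C "C + 1"] frequently_elim1[OF freq, of "\<lambda>n. x n \<le> C"] by auto
  then have e1: "\<forall>\<^sub>F n in sequentially. x n < C + 1"
    by (simp add: not_frequently not_le)
  have "\<not> (\<exists>\<^sub>F n in sequentially. x n \<le> - C - 1)"
    using no_osc[of "- C - 1" "- C"] frequently_elim1[OF freq, of "\<lambda>n. - C \<le> x n"] by auto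
  then have e2: "\<forall>\<^sub>F n in sequentially. - C - 1 < x n"
    by (simp add: not_frequently not_le)
  have "\<forall>\<^sub>F n in sequentially. norm (x n) \<le> C + 1"
    using e1 e2 by eventually_elim auto
  then have "Bseq x" by (rule BfunI)
  then have "bounded (range x)" by (simp add: Bseq_eq_bounded)
  \<comment> \<open>A subsequential limit \<open>l\<close> is the candidate: a sequence that keeps
    returning near \<open>l\<close> cannot also leave a fixed neighbourhood of \<open>l\<close>
    infinitely often.\<close>
  then obtain l r where r: "strict_mono r" "(x \<circ> r) \<longlonglongrightarrow> l"
    using bounded_imp_convergent_subsequence by blast
  have near: "\<exists>\<^sub>F n in sequentially. P (x n)" if ev: "\<forall>\<^sub>F n in sequentially. P ((x \<circ> r) n)" for P
    unfolding frequently_sequentially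
  proof
    fix m
    obtain N where "\<And>n. n \<ge> N \<Longrightarrow> P ((x \<circ> r) n)"
      using ev unfolding eventually_sequentially by blast
    then show "\<exists>n\<ge>m. P (x n)"
      using seq_suble[OF r(1), of "max N m"]
      by (intro exI[of _ "r (max N m)"]) auto
  qed
  have "\<forall>\<^sub>F n in sequentially. dist (x n) l < e" if "e > 0" for e
  proof -
    have "\<exists>\<^sub>F n in sequentially. l - e / 2 \<le> x n"
      by (rule near, rule eventually_mono[OF order_tendstoD(1)[OF r(2), of "l - e/2"]]) (use that in auto)
    then have "\<not> (\<exists>\<^sub>F n in sequentially. x n \<le> l - e)"
      using no_osc[of "l - e" "l - e/2"] that by auto
    moreover have "\<exists>\<^sub>F n in sequentially. x n \<le> l + e / 2"
      by (rule near, rule eventually_mono[OF order_tendstoD(2)[OF r(2), of "l + e/2"]]) (use that in auto)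
    then have "\<not> (\<exists>\<^sub>F n in sequentially. l + e \<le> x n)"
      using no_osc[of "l + e/2" "l + e"] that by auto
    ultimately have "\<forall>\<^sub>F n in sequentially. l - e < x n" "\<forall>\<^sub>F n in sequentially. x n < l + e"
      by (simp_all add: not_frequently not_le)
    then show ?thesis by eventually_elim (auto simp: dist_real_def)
  qed
  then show ?thesis unfolding convergent_def tendsto_iff by blast
qed

text \<open>By Fatou's lemma the lower limit has finite integral, hence is finite almost everywhere,
  which forbids \<open>f n x\<close> to exceed every bound eventually. It serves for upcrossing
  counts as well as for \<open>\<bar>X n\<bar>\<close>.\<close>

lemma AE_frequently_bounded:
  fixes f :: "nat \<Rightarrow> 'a \<Rightarrow> real"
  assumes [measurable]: "\<And>n. integrable M (f n)"
    and nonneg: "\<And>n x. 0 \<le> f n x"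
    and le: "\<And>n. (\<integral>x. f n x \<partial>M) \<le> K"
  shows "AE x in M. \<exists>C. \<exists>\<^sub>F n in sequentially. f n x \<le> C"
proof -
  have [measurable]: "f n \<in> borel_measurable M" for n using assms(1) by auto
  have "(\<integral>\<^sup>+x. liminf (\<lambda>n. ennreal (f n x)) \<partial>M) \<le> liminf (\<lambda>n. \<integral>\<^sup>+x. ennreal (f n x) \<partial>M)"
    by (rule nn_integral_liminf) simp
  also have "\<dots> \<le> liminf (\<lambda>n. ennreal K)"
    by (rule Liminf_mono, rule always_eventually)
      (use assms in \<open>auto simp: nn_integral_eq_integral intro!: ennreal_leI\<close>)
  also have "\<dots> < \<infinity>" by (simp add: Liminf_const)
  finally have "AE x in M. liminf (\<lambda>n. ennreal (f n x)) \<noteq> \<infinity>"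
    by (intro nn_integral_noteq_infinite) auto
  then show ?thesis
  proof (rule AE_mp, intro AE_I2 impI)
    fix x assume *: "liminf (\<lambda>n. ennreal (f n x)) \<noteq> \<infinity>"
    show "\<exists>C. \<exists>\<^sub>F n in sequentially. f n x \<le> C"
    proof (rule ccontr)
      assume "\<not> (\<exists>C. \<exists>\<^sub>F n in sequentially. f n x \<le> C)"
      then have gt: "\<forall>\<^sub>F n in sequentially. C < f n x" for C
        by (simp add: not_frequently not_le)
      have ev: "\<forall>\<^sub>F n in sequentially. ennreal (real k) \<le> ennreal (f n x)" for k :: nat
        using gt[of "real k"] by eventually_elim (auto intro!: ennreal_leI)
      have "ennreal (real k) \<le> liminf (\<lambda>n. ennreal (f n x))" for k :: nat
        using ev[of k] by (rule Liminf_bounded)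
      then have "liminf (\<lambda>n. ennreal (f n x)) = \<infinity>"
        by (metis ennreal_Ex_less_of_nat ennreal_of_nat_eq_real_of_nat infinity_ennreal_def
            leD top.not_eq_extremum)
      with * show False by simp
    qed
  qed
qed

text \<open>The hypothesis \<open>martingale\<close> asks that the increment after time \<open>n\<close> integrates to zero over
  every event determined by the values up to time \<open>n\<close>.\<close>

theorem martingale_convergence:
  fixes X :: "nat \<Rightarrow> 'a \<Rightarrow> real"
  assumes "finite_measure M"
    and integrable: "\<And>n. integrable M (X n)"
    and L1_bounded: "\<And>n. (\<integral>x. \<bar>X n x\<bar> \<partial>M) \<le> K"
    and martingale: "\<And>n A. A \<in> sets M \<Longrightarrow>
      (\<And>x y. x \<in> space M \<Longrightarrow> y \<in> space M \<Longrightarrow> (\<And>i. i \<le> n \<Longrightarrow> X i x = X i y) \<Longrightarrow> x \<in> A \<longleftrightarrow> y \<in> A) \<Longrightarrow>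
      (\<integral>x. indicator A x * (X (Suc n) x - X n x) \<partial>M) = 0"
  shows "\<exists>F. integrable M F \<and> (AE x in M. (\<lambda>n. X n x) \<longlonglongrightarrow> F x)"
proof -
  have const: "integrable M (\<lambda>x. r)" for r :: real
    by (rule finite_measure.integrable_const) fact
  have [measurable]: "X n \<in> borel_measurable M" for n using integrable by auto
  define \<X> where "\<X> x n = X n x" for x n
  have hm[measurable]: "Measurable.pred M (\<lambda>x. holding a b (\<X> x) n)" for a b n
    by (induction n) (auto simp: \<X>_def)
  have um[measurable]: "(\<lambda>x. upcrossings a b (\<X> x) n) \<in> measurable M (count_space UNIV)" for a b n
  proof (induction n)
    case (Suc n)
    note Suc[measurable]
    show ?case unfolding upcrossings.simps of_bool_def \<X>_def[of _ "Suc n"] by measurable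
  qed simp
  \<comment> \<open>Doob's bound: the betting strategy has expected gain zero, so the expected
    number of upcrossings stays bounded in time.\<close>
  have up: "AE x in M. \<exists>B. \<forall>n. upcrossings a b (\<X> x) n < B" if "a < b" for a b
  proof -
    have upc_le: "real (upcrossings a b x n) \<le> real n" for x n
      by (induction n) auto
    have iu: "integrable M (\<lambda>x. real (upcrossings a b (\<X> x) n))" for n
      by (rule finite_measure.integrable_const_bound[OF \<open>finite_measure M\<close>, where B = "real n"])
        (use upc_le in auto)
    define g where "g k x = of_bool (holding a b (\<X> x) k) * (X (Suc k) x - X k x)" for k x
    have ig: "integrable M (g k)" for k
      unfolding g_def by (rule Bochner_Integration.integrable_bound[of _ "\<lambda>x. X (Suc k) x - X k x"]) (auto simp: integrable)
    have zero: "(\<integral>x. g k x \<partial>M) = 0" for k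
    proof -
      define A where "A = {x \<in> space M. holding a b (\<X> x) k}"
      have "(\<integral>x. indicator A x * (X (Suc k) x - X k x) \<partial>M) = 0"
      proof (rule martingale)
        show "A \<in> sets M" unfolding A_def by measurable
        show "x \<in> A \<longleftrightarrow> y \<in> A"
          if "x \<in> space M" "y \<in> space M" "\<And>i. i \<le> k \<Longrightarrow> X i x = X i y" for x y
          using holding_cong[of k "\<X> x" "\<X> y"] that by (auto simp: A_def \<X>_def)
      qed
      also have "(\<integral>x. indicator A x * (X (Suc k) x - X k x) \<partial>M)
          = (\<integral>x. g k x \<partial>M)"
        by (rule Bochner_Integration.integral_cong) (auto simp: A_def g_def indicator_def)
      finally show ?thesis .
    qed
    have "(\<integral>x. real (upcrossings a b (\<X> x) n) \<partial>M) \<le> (K + \<bar>a\<bar> * measure M (space M)) / (b - a)" for n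
    proof -
      have "(b - a) * (\<integral>x. real (upcrossings a b (\<X> x) n) \<partial>M)
          = (\<integral>x. (b - a) * real (upcrossings a b (\<X> x) n) \<partial>M)" by simp
      also have "\<dots> \<le> (\<integral>x. (\<Sum>k<n. g k x) + \<bar>X n x\<bar> + \<bar>a\<bar> \<partial>M)"
      proof (rule integral_mono)
        show "(b - a) * real (upcrossings a b (\<X> x) n)
            \<le> (\<Sum>k<n. g k x) + \<bar>X n x\<bar> + \<bar>a\<bar>" for x
          using upcrossings_le_gain[of b a "\<X> x" n] unfolding g_def by (simp only: \<X>_def)
      qed (use iu ig integrable const in \<open>auto intro!: Bochner_Integration.integrable_add Bochner_Integration.integrable_sum\<close>)
      also have "\<dots> = (\<integral>x. \<bar>X n x\<bar> \<partial>M) + \<bar>a\<bar> * measure M (space M)"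
        using ig integrable zero const
        by (simp add: Bochner_Integration.integrable_sum Bochner_Integration.integral_sum mult.commute)
      also have "\<dots> \<le> K + \<bar>a\<bar> * measure M (space M)" using L1_bounded by simp
      finally show ?thesis using that by (simp add: field_simps)
    qed
    then have "AE x in M. \<exists>C. \<exists>\<^sub>F n in sequentially. real (upcrossings a b (\<X> x) n) \<le> C"
      by (intro AE_frequently_bounded iu) auto
    then show ?thesis
    proof (rule AE_mp, intro AE_I2 impI)
      fix x assume "\<exists>C. \<exists>\<^sub>F n in sequentially. real (upcrossings a b (\<X> x) n) \<le> C"
      then obtain C where C: "\<And>m. \<exists>n\<ge>m. real (upcrossings a b (\<X> x) n) \<le> C"
        unfolding frequently_sequentially by blast
      \<comment> \<open>Counts only grow, so a bound met at arbitrarily late times holds at all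
        times.\<close>
      have "upcrossings a b (\<X> x) m < Suc (nat \<lfloor>C\<rfloor>)" for m
      proof -
        obtain n where n: "n \<ge> m" "real (upcrossings a b (\<X> x) n) \<le> C" using C by blast
        show ?thesis using n upcrossings_mono[OF n(1), of a b "\<X> x"] by linarith
      qed
      then show "\<exists>B. \<forall>n. upcrossings a b (\<X> x) n < B" by blast
    qed
  qed
  \<comment> \<open>Quantifying over rational levels keeps the union of null sets countable.\<close>
  have "AE x in M. \<forall>a\<in>\<rat>. \<forall>b\<in>\<rat>. a < b \<longrightarrow> (\<exists>B. \<forall>n. upcrossings a b (\<X> x) n < B)"
    using up by (intro AE_ball_countable' countable_rat) (auto intro: AE_impI)
  moreover have fb: "AE x in M. \<exists>C. \<exists>\<^sub>F n in sequentially. \<bar>X n x\<bar> \<le> C"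
    by (rule AE_frequently_bounded[where K = K]) (use integrable L1_bounded in auto)
  ultimately have conv: "AE x in M. convergent (\<lambda>n. X n x)"
  proof eventually_elim
    case (elim x)
    then obtain C where "\<exists>\<^sub>F n in sequentially. \<bar>\<X> x n\<bar> \<le> C" unfolding \<X>_def by blast
    then have "convergent (\<X> x)"
      using elim(1) by (intro convergent_if_upcrossings_bounded[of "\<X> x" C]) auto
    then show ?case by (simp add: \<X>_def[abs_def])
  qed
  define F where "F x = lim (\<lambda>n. X n x)" for x
  have [measurable]: "F \<in> borel_measurable M" unfolding F_def[abs_def] by measurable
  have lim: "AE x in M. (\<lambda>n. X n x) \<longlonglongrightarrow> F x"
    using conv by eventually_elim (simp add: F_def convergent_LIMSEQ_iff)
  \<comment> \<open>Fatou's lemma carries the \<open>L1\<close> bound over to the limit.\<close>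
  have "(\<integral>\<^sup>+x. ennreal (norm (F x)) \<partial>M) = (\<integral>\<^sup>+x. liminf (\<lambda>n. ennreal (norm (X n x))) \<partial>M)"
  proof (rule nn_integral_cong_AE)
    show "AE x in M. ennreal (norm (F x)) = liminf (\<lambda>n. ennreal (norm (X n x)))"
      using lim
    proof eventually_elim
      case (elim x)
      then have "(\<lambda>n. ennreal (norm (X n x))) \<longlonglongrightarrow> ennreal (norm (F x))"
        by (intro tendsto_intros tendsto_ennrealI)
      from lim_imp_Liminf[OF sequentially_bot this] show ?case by (rule sym)
    qed
  qed
  also have "\<dots> \<le> liminf (\<lambda>n. \<integral>\<^sup>+x. ennreal (norm (X n x)) \<partial>M)"
    by (rule nn_integral_liminf) simp
  also have "\<dots> \<le> liminf (\<lambda>n. ennreal K)"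
    by (rule Liminf_mono, rule always_eventually)
      (use L1_bounded integrable in \<open>auto simp: nn_integral_eq_integral intro!: ennreal_leI\<close>)
  also have "\<dots> < \<infinity>" by (simp add: Liminf_const)
  finally have "integrable M F" by (intro integrableI_bounded) auto
  with lim show ?thesis by blast
qed

section \<open>Farey pairs\<close>

lemma height_divide:
  assumes "coprime a b" "b > 0"
  shows "height (of_int a / of_int b) = nat b"
  using assms by (simp add: height_def flip: Fract_of_int_quotient add: quotient_of_Fract normalize_def)

lemma height_0: "height 0 = 1"
  by (simp add: height_def)

lemma rat_eq_divide_height:
  obtains a where "\<beta> = of_int a / of_int (int (height \<beta>))" "coprime a (int (height \<beta>))"
    "height \<beta> > 0"
proof -
  obtain a b where ab: "quotient_of \<beta> = (a, b)" by force
  then have "b > 0" "coprime a b" "\<beta> = of_int a / of_int b"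
    using quotient_of_denom_pos quotient_of_coprime quotient_of_div by blast+
  with ab that[of a] show thesis by (simp add: height_def)
qed

lemma finite_farey: "finite (farey Q)"
proof (rule finite_subset)
  show "farey Q \<subseteq> (\<lambda>(a, b). of_int a / of_int b) ` ({0..int Q} \<times> {0..int Q})"
  proof
    fix \<beta> assume \<beta>: "\<beta> \<in> farey Q"
    obtain a where a: "\<beta> = of_int a / of_int (int (height \<beta>))" "height \<beta> > 0"
      by (rule rat_eq_divide_height)
    define b where "b = int (height \<beta>)"
    have b: "b > 0" "\<beta> = of_int a / of_int b" "b \<le> int Q"
      using a \<beta> by (auto simp: b_def farey_def)
    have "0 \<le> (of_int a :: rat)" "(of_int a :: rat) < of_int b"
      using \<beta> b(1) unfolding b(2) by (auto simp: farey_def zero_le_divide_iff divide_less_eq_1)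
    then have "0 \<le> a" "a < b" by (simp_all only: of_int_0_le_iff of_int_less_iff)
    then show "\<beta> \<in> (\<lambda>(a, b). of_int a / of_int b) ` ({0..int Q} \<times> {0..int Q})"
      using b by (intro image_eqI[of _ _ "(a, b)"]) auto
  qed
qed auto

section \<open>Unimodular pairs and their mediants\<close>

text \<open>Fractions \<open>p/q < r/s\<close> in \<open>[0,1]\<close> with determinant 1. The right
  end may be \<open>1/1\<close>: the point 0 of the circle is carried as 1 when it is the right
  neighbour.\<close>

definition farey_pair :: "int \<Rightarrow> int \<Rightarrow> int \<Rightarrow> int \<Rightarrow> bool" where
  "farey_pair p q r s \<longleftrightarrow> 0 < q \<and> 0 < s \<and> 0 \<le> p \<and> r \<le> s \<and> r * q - p * s = 1"

text \<open>A common divisor divides the determinant, and the determinant of the mediant against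
  \<open>p/q\<close> is again 1.\<close>

lemma farey_pair_coprime:
  assumes "farey_pair p q r s"
  shows "coprime p q" "coprime r s" "coprime (p + r) (q + s)"
proof -
  have d: "r * q - p * s = 1" using assms by (simp add: farey_pair_def)
  show "coprime p q"
  proof (rule coprimeI)
    fix c assume "c dvd p" "c dvd q"
    then have "c dvd r * q - p * s" by simp
    then show "is_unit c" using d by simp
  qed
  show "coprime r s"
  proof (rule coprimeI)
    fix c assume "c dvd r" "c dvd s"
    then have "c dvd r * q - p * s" by simp
    then show "is_unit c" using d by simp
  qed
  show "coprime (p + r) (q + s)"
  proof (rule coprimeI)
    fix c assume "c dvd p + r" "c dvd q + s"
    then have "c dvd (p + r) * q - p * (q + s)" by simp
    also have "(p + r) * q - p * (q + s) = 1" using d by (simp add: algebra_simps)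
    finally show "is_unit c" .
  qed
qed

lemma farey_pair_height:
  assumes "farey_pair p q r s"
  shows "height (of_int p / of_int q) = nat q" "height (of_int r / of_int s) = nat s"
    "height (of_int (p + r) / of_int (q + s)) = nat (q + s)"
  using farey_pair_coprime[OF assms] assms
  by (auto intro!: height_divide simp: farey_pair_def simp del: of_int_add)

lemma farey_pair_order:
  assumes "farey_pair p q r s"
  shows "0 \<le> real_of_int p / of_int q"
    "real_of_int p / of_int q < of_int (p + r) / of_int (q + s)"
    "real_of_int (p + r) / of_int (q + s) < of_int r / of_int s"
    "real_of_int r / of_int s \<le> 1"
proof -
  have *: "0 < q" "0 < s" "0 \<le> p" "r \<le> s" and d: "r * q - p * s = 1"
    using assms by (auto simp: farey_pair_def)
  have d': "real_of_int r * q - p * s = 1"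
    using arg_cong[OF d, of real_of_int] by simp
  show "0 \<le> real_of_int p / of_int q" "real_of_int r / of_int s \<le> 1" using * by auto
  show "real_of_int p / of_int q < of_int (p + r) / of_int (q + s)"
    "real_of_int (p + r) / of_int (q + s) < of_int r / of_int s"
    using * d' by (auto simp: field_simps)
qed

text \<open>In the lattice basis \<open>(p, q)\<close>, \<open>(r, s)\<close> a fraction strictly
  inside has positive integer coordinates, so its denominator is at least \<open>q + s\<close>, with
  equality only for the mediant.\<close>

lemma farey_pair_between:
  assumes fp: "farey_pair p q r s"
    and x: "real_of_int p / of_int q < of_rat x" "of_rat x < real_of_int r / of_int s"
    and h: "int (height x) \<le> q + s"
  shows "x = of_int (p + r) / of_int (q + s)"
proof -
  have *: "0 < q" "0 < s" and d: "r * q - p * s = 1"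
    using fp by (auto simp: farey_pair_def)
  obtain a where a: "x = of_int a / of_int (int (height x))" "height x > 0"
    by (rule rat_eq_divide_height)
  define b where "b = int (height x)"
  have b: "b > 0" "x = of_int a / of_int b" "b \<le> q + s" using a h by (auto simp: b_def)
  have xr: "of_rat x = real_of_int a / of_int b" by (simp add: b(2) of_rat_divide)
  have "real_of_int (p * b) < of_int (a * q)" "real_of_int (a * s) < of_int (r * b)"
    using x * b unfolding xr by (auto simp: field_simps)
  then have "p * b < a * q" "a * s < r * b" by (simp_all only: of_int_less_iff)
  \<comment> \<open>Cramer's rule with determinant 1:
    \<open>(a, b) = u (p, q) + v (r, s)\<close>.\<close>
  define u where "u = r * b - a * s"
  define v where "v = a * q - p * b"
  have uv: "u \<ge> 1" "v \<ge> 1" using \<open>p * b < a * q\<close> \<open>a * s < r * b\<close> by (auto simp: u_def v_def)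
  have "u * q + v * s = b * (r * q - p * s)" "u * p + v * r = a * (r * q - p * s)"
    by (simp_all add: u_def v_def algebra_simps)
  then have bq: "b = u * q + v * s" and ap: "a = u * p + v * r" using d by auto
  have "u = 1 \<and> v = 1"
  proof (rule ccontr)
    assume "\<not> (u = 1 \<and> v = 1)"
    then have "u \<ge> 2 \<or> v \<ge> 2" using uv by auto
    then have "u * q + v * s > q + s"
    proof
      assume "u \<ge> 2"
      then have "u * q \<ge> 2 * q" "v * s \<ge> 1 * s" using uv * by (auto intro!: mult_right_mono)
      then show ?thesis using * by linarith
    next
      assume "v \<ge> 2"
      then have "v * s \<ge> 2 * s" "u * q \<ge> 1 * q" using uv * by (auto intro!: mult_right_mono)
      then show ?thesis using * by linarith
    qed
    then show False using bq b by simp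
  qed
  then show ?thesis using b bq ap by simp
qed

text \<open>The parents of \<open>a/b\<close> come from Bezout: \<open>q\<close> is the inverse of
  \<open>a\<close> modulo \<open>b\<close>, \<open>p\<close> solves
  \<open>a * q - b * p = 1\<close>, and the other parent is \<open>(a - p)/(b - q)\<close>.\<close>

lemma farey_pair_exists:
  fixes \<beta> :: rat
  assumes "0 < \<beta>" "\<beta> < 1"
  obtains p q r s where "farey_pair p q r s" "\<beta> = of_int (p + r) / of_int (q + s)"
    "int (height \<beta>) = q + s"
proof -
  obtain a where a: "\<beta> = of_int a / of_int (int (height \<beta>))" "coprime a (int (height \<beta>))" "height \<beta> > 0"
    by (rule rat_eq_divide_height)
  define b where "b = int (height \<beta>)"
  have b: "b > 0" "\<beta> = of_int a / of_int b" "coprime a b" using a by (auto simp: b_def)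
  have "0 < (of_int a :: rat)" "(of_int a :: rat) < of_int b"
    using assms b by (auto simp: zero_less_divide_iff divide_less_eq_1)
  then have ab: "0 < a" "a < b" by (simp_all only: of_int_0_less_iff of_int_less_iff)
  obtain u v where uv: "a * u + b * v = 1"
    using b(3) bezout_int[of a b] by (auto simp: coprime_iff_gcd_eq_1 mult.commute)
  define q where "q = u mod b"
  define p where "p = a * (q - u) div b - v"
  have "b dvd q - u" unfolding q_def by (simp add: mod_eq_dvd_iff[symmetric])
  then obtain k where k: "q - u = b * k" by blast
  have p: "p = a * k - v" using b by (simp add: p_def k)
  have det: "a * q - b * p = 1"
  proof -
    have "a * q - b * p = a * (q - u) + a * u - b * a * k + b * v" by (simp add: p algebra_simps)
    also have "\<dots> = 1" using uv by (simp add: k)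
    finally show ?thesis .
  qed
  have q: "0 \<le> q" "q < b" using b by (auto simp: q_def)
  have "q \<noteq> 0"
  proof
    assume "q = 0"
    with det have "b * (- p) = 1" by simp
    then have "b dvd 1" by (metis dvd_triv_left)
    then show False using ab by simp
  qed
  with q have q0: "0 < q" by simp
  have "a * q \<ge> 1" using q0 ab by (metis int_one_le_iff_zero_less mult_pos_pos)
  then have "b * p \<ge> 0" using det by linarith
  then have p0: "0 \<le> p" using b by (simp add: zero_le_mult_iff)
  \<comment> \<open>The right parent does not exceed 1: otherwise
    \<open>q \<ge> p + (b - a) + 1\<close>, and with \<open>p < a\<close> the determinant equation
    would force \<open>b \<le> 1\<close>.\<close>
  have "a - p \<le> b - q"
  proof (rule ccontr)
    assume "\<not> a - p \<le> b - q"
    then have "p + (b - a) + 1 \<le> q" by simp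
    then have "a * (p + (b - a) + 1) \<le> a * q" using ab by (intro mult_left_mono) auto
    moreover have "(b - a) * p \<le> (b - a) * (a - 1)"
    proof -
      have "b * p < b * a"
      proof -
        have "a * q < a * b" using ab q by simp
        then show ?thesis using det by (simp add: mult.commute)
      qed
      then have "p < a" using b by simp
      then show ?thesis using ab by (intro mult_left_mono) auto
    qed
    ultimately have "a * (p + (b - a) + 1) \<le> 1 + b * p" "(b - a) * p \<le> (b - a) * (a - 1)"
      using det by linarith+
    then show False using ab by (simp add: algebra_simps)
  qed
  then have "farey_pair p q (a - p) (b - q)"
    using q q0 p0 det unfolding farey_pair_def by (simp add: algebra_simps)
  then show thesis by (rule that) (simp add: b(2), simp add: b_def)
qed

section \<open>Neighbours of a fraction on the circle\<close>

lemma frac_eq_add_one: "-1 \<le> x \<Longrightarrow> x < 0 \<Longrightarrow> frac x = x + (1::real)"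
  by (simp add: frac_unique_iff)

text \<open>By \<open>farey_pair_between\<close> only the mediant lies strictly inside the pair at
  this height, so the arc from \<open>p/q\<close> is empty. Any other candidate has an arc to the
  mediant that passes through \<open>p/q\<close>.\<close>

lemma left_nbr_farey_pair:
  assumes fp: "farey_pair p q r s"
  shows "left_nbr (of_int (p + r) / of_int (q + s)) = of_int p / of_int q"
proof -
  define \<beta> :: rat where "\<beta> = of_int (p + r) / of_int (q + s)"
  define l :: rat where "l = of_int p / of_int q"
  have *: "0 < q" "0 < s" using fp by (auto simp: farey_pair_def)
  have h: "int (height \<beta>) = q + s" "int (height l) = q"
    using farey_pair_height[OF fp] * by (simp_all add: \<beta>_def l_def)
  have rl: "of_rat l = real_of_int p / of_int q" by (simp add: l_def of_rat_divide)
  have rb: "of_rat \<beta> = real_of_int (p + r) / of_int (q + s)" by (simp add: \<beta>_def of_rat_divide of_rat_add)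
  note o = farey_pair_order[OF fp, folded rl rb]
  have o': "0 \<le> l" "l < \<beta>" "\<beta> < 1"
    using o less_le_trans[OF o(3,4)] by (simp_all add: of_rat_less)
  note bet = farey_pair_between[OF fp, folded rl \<beta>_def]
  have "left_nbr \<beta> = l"
    unfolding left_nbr_def
  proof (rule the_equality, intro conjI)
    show "l \<in> farey (height \<beta>)" using h * o' by (auto simp: farey_def)
    show "l \<noteq> \<beta>" using o' by simp
    show "arc_between (of_rat l) (of_rat \<beta>) \<inter> of_rat ` farey (height \<beta>) = {}"
    proof (rule ccontr)
      assume "arc_between (of_rat l) (of_rat \<beta>) \<inter> real_of_rat ` farey (height \<beta>) \<noteq> {}"
      then obtain t \<gamma> where t: "0 < t" "t < frac (of_rat \<beta> - of_rat l :: real)"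
        "frac (of_rat l + t) = real_of_rat \<gamma>" "\<gamma> \<in> farey (height \<beta>)"
        unfolding arc_between_def by fastforce
      have "frac (of_rat \<beta> - of_rat l :: real) = of_rat \<beta> - of_rat l"
        using o by (intro iffD2[OF frac_eq] conjI; linarith)
      moreover from this have "frac (of_rat l + t) = of_rat l + t"
        using o t by (intro iffD2[OF frac_eq] conjI; linarith)
      ultimately have g: "of_rat l < real_of_rat \<gamma>" "real_of_rat \<gamma> < of_rat \<beta>" using t by linarith+
      then have "\<gamma> = \<beta>" using bet[of \<gamma>] o t(4) h by (auto simp: farey_def)
      then show False using g by simp
    qed
  next
    fix \<gamma> assume "\<gamma> \<in> farey (height \<beta>) \<and> \<gamma> \<noteq> \<beta> \<and>
      arc_between (of_rat \<gamma>) (of_rat \<beta>) \<inter> of_rat ` farey (height \<beta>) = {}"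
    then have g: "0 \<le> \<gamma>" "\<gamma> < 1" "height \<gamma> \<le> height \<beta>" "\<gamma> \<noteq> \<beta>"
      and empty: "arc_between (of_rat \<gamma>) (of_rat \<beta>) \<inter> of_rat ` farey (height \<beta>) = {}"
      by (auto simp: farey_def)
    have "l \<in> farey (height \<beta>)" using h * o' by (auto simp: farey_def)
    with empty have nin: "real_of_rat l \<notin> arc_between (of_rat \<gamma>) (of_rat \<beta>)" by blast
    have g': "0 \<le> real_of_rat \<gamma>" "real_of_rat \<gamma> < 1" using g by simp_all
    show "\<gamma> = l"
    proof (rule ccontr)
      assume "\<gamma> \<noteq> l"
      have "\<not> (l < \<gamma> \<and> \<gamma> < \<beta>)"
      proof
        assume a: "l < \<gamma> \<and> \<gamma> < \<beta>"
        then have "real_of_rat l < of_rat \<gamma>" "real_of_rat \<gamma> < of_rat \<beta>" by (simp_all add: of_rat_less)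
        then have "\<gamma> = \<beta>" using bet[of \<gamma>] o g(3) h by auto
        then show False using g by simp
      qed
      \<comment> \<open>The arc from \<open>\<gamma>\<close> reaches \<open>l\<close> directly in
        the first case and by passing 0 in the second, whence the summand 1 there.\<close>
      then consider "\<gamma> < l" | "\<beta> < \<gamma>" using g \<open>\<gamma> \<noteq> l\<close> by fastforce
      then show False
      proof cases
        case 1
        then have gl: "real_of_rat \<gamma> < of_rat l" by (simp add: of_rat_less)
        have "frac (of_rat \<beta> - of_rat \<gamma> :: real) = of_rat \<beta> - of_rat \<gamma>"
          using o gl g' by (intro iffD2[OF frac_eq] conjI; linarith)
        moreover have "frac (real_of_rat l) = of_rat l" using o by (intro iffD2[OF frac_eq] conjI; linarith)
        ultimately have "real_of_rat l \<in> arc_between (of_rat \<gamma>) (of_rat \<beta>)"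
          unfolding arc_between_def using o gl
          by (intro CollectI exI[of _ "real_of_rat l - of_rat \<gamma>"]) auto
        then show False using nin by blast
      next
        case 2
        then have gl: "real_of_rat \<beta> < of_rat \<gamma>" by (simp add: of_rat_less)
        have "frac (of_rat \<beta> - of_rat \<gamma> :: real) = of_rat \<beta> - of_rat \<gamma> + 1"
          using o gl g' by (intro frac_eq_add_one; linarith)
        moreover have "frac (real_of_rat l + 1) = of_rat l" using o
          by (simp only: frac_1_eq) (intro iffD2[OF frac_eq] conjI; linarith)
        moreover have "0 < real_of_rat l - of_rat \<gamma> + 1" using o g' by linarith
        ultimately have "real_of_rat l \<in> arc_between (of_rat \<gamma>) (of_rat \<beta>)"
          unfolding arc_between_def using o
          by (intro CollectI exI[of _ "real_of_rat l - of_rat \<gamma> + 1"]) auto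
        then show False using nin by blast
      qed
    qed
  qed
  then show ?thesis by (simp add: \<beta>_def l_def)
qed

text \<open>The mirror image of the argument for the left neighbour, except that a right end
  \<open>1/1\<close> has representative 0. Arc lengths are therefore measured to the unreduced end
  \<open>t\<close>.\<close>

lemma right_nbr_farey_pair:
  assumes fp: "farey_pair p q r s"
  shows "right_nbr (of_int (p + r) / of_int (q + s)) = (if r = s then 0 else of_int r / of_int s)"
proof -
  define \<beta> :: rat where "\<beta> = of_int (p + r) / of_int (q + s)"
  define t :: rat where "t = of_int r / of_int s"
  define R :: rat where "R = (if r = s then 0 else t)"
  have *: "0 < q" "0 < s" "0 \<le> p" "r \<le> s" "r * q - p * s = 1" using fp by (auto simp: farey_pair_def)
  have h: "int (height \<beta>) = q + s" "int (height t) = s"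
    using farey_pair_height[OF fp] * by (simp_all add: \<beta>_def t_def)
  have rt: "of_rat t = real_of_int r / of_int s" by (simp add: t_def of_rat_divide)
  have rb: "of_rat \<beta> = real_of_int (p + r) / of_int (q + s)" by (simp add: \<beta>_def of_rat_divide of_rat_add)
  note o = farey_pair_order[OF fp, folded rt rb]
  have b0: "0 < real_of_rat \<beta>" using o by linarith
  have o': "0 < \<beta>" "\<beta> < t" "t \<le> 1" using b0 o by (simp_all add: of_rat_less)
  have t1: "t = 1 \<longleftrightarrow> r = s" using * by (auto simp: t_def)
  have R: "real_of_rat R = (if t = 1 then 0 else of_rat t)" by (simp add: R_def t1)
  have fR: "real_of_rat R = frac (of_rat t)"
    using o b0 o' by (cases "t = 1") (auto simp: R frac_eq)
  have Rin: "R \<in> farey (height \<beta>)"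
    using h * o' t1 by (auto simp: farey_def R_def height_0)
  note bet = farey_pair_between[OF fp, folded rt \<beta>_def]
  have frt: "frac (of_rat R - of_rat \<beta> :: real) = of_rat t - of_rat \<beta>"
  proof (cases "t = 1")
    case True
    then show ?thesis using o b0 by (simp add: R frac_eq_add_one)
  next
    case False
    then have "real_of_rat R = of_rat t" by (simp add: R)
    moreover have "frac (of_rat t - of_rat \<beta> :: real) = of_rat t - of_rat \<beta>"
      using o b0 by (intro iffD2[OF frac_eq] conjI; linarith)
    ultimately show ?thesis by simp
  qed
  have "right_nbr \<beta> = R"
    unfolding right_nbr_def
  proof (rule the_equality, intro conjI)
    show "R \<in> farey (height \<beta>)" by fact
    show "R \<noteq> \<beta>" using o' by (auto simp: R_def)
    show "arc_between (of_rat \<beta>) (of_rat R) \<inter> of_rat ` farey (height \<beta>) = {}"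
    proof (rule ccontr)
      assume "arc_between (of_rat \<beta>) (of_rat R) \<inter> real_of_rat ` farey (height \<beta>) \<noteq> {}"
      then obtain d \<gamma> where d: "0 < d" "d < frac (of_rat R - of_rat \<beta> :: real)"
        "frac (of_rat \<beta> + d) = real_of_rat \<gamma>" "\<gamma> \<in> farey (height \<beta>)"
        unfolding arc_between_def by fastforce
      have "frac (of_rat \<beta> + d) = of_rat \<beta> + d"
        using o b0 d frt by (intro iffD2[OF frac_eq] conjI; linarith)
      then have g: "of_rat \<beta> < real_of_rat \<gamma>" "real_of_rat \<gamma> < of_rat t" using d frt by linarith+
      then have "\<gamma> = \<beta>" using bet[of \<gamma>] o d(4) h by (auto simp: farey_def)
      then show False using g by simp
    qed
  next
    fix \<gamma> assume "\<gamma> \<in> farey (height \<beta>) \<and> \<gamma> \<noteq> \<beta> \<and>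
      arc_between (of_rat \<beta>) (of_rat \<gamma>) \<inter> of_rat ` farey (height \<beta>) = {}"
    then have g: "0 \<le> \<gamma>" "\<gamma> < 1" "height \<gamma> \<le> height \<beta>" "\<gamma> \<noteq> \<beta>"
      and empty: "arc_between (of_rat \<beta>) (of_rat \<gamma>) \<inter> of_rat ` farey (height \<beta>) = {}"
      by (auto simp: farey_def)
    with Rin have nin: "real_of_rat R \<notin> arc_between (of_rat \<beta>) (of_rat \<gamma>)" by blast
    have g': "0 \<le> real_of_rat \<gamma>" "real_of_rat \<gamma> < 1" using g by simp_all
    show "\<gamma> = R"
    proof (rule ccontr)
      assume "\<gamma> \<noteq> R"
      have "\<not> (\<beta> < \<gamma> \<and> \<gamma> < t)"
      proof
        assume a: "\<beta> < \<gamma> \<and> \<gamma> < t"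
        then have "real_of_rat \<beta> < of_rat \<gamma>" "real_of_rat \<gamma> < of_rat t" by (simp_all add: of_rat_less)
        then have "\<gamma> = \<beta>" using bet[of \<gamma>] o g(3) h by auto
        then show False using g by simp
      qed
      moreover have "\<gamma> \<noteq> t" using \<open>\<gamma> \<noteq> R\<close> g t1 by (auto simp: R_def split: if_splits)
      ultimately consider "t < \<gamma>" | "\<gamma> < \<beta>" using g by fastforce
      \<comment> \<open>Every other candidate is further from \<open>\<beta>\<close> in the positive
        direction than \<open>R\<close>, so its arc contains \<open>R\<close>.\<close>
      then have "of_rat t - of_rat \<beta> < frac (of_rat \<gamma> - of_rat \<beta> :: real)"
      proof cases
        case 1
        then have gl: "real_of_rat t < of_rat \<gamma>" by (simp add: of_rat_less)
        then have "frac (of_rat \<gamma> - of_rat \<beta> :: real) = of_rat \<gamma> - of_rat \<beta>"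
          using o b0 g' by (intro iffD2[OF frac_eq] conjI; linarith)
        then show ?thesis using gl by simp
      next
        case 2
        then have gl: "real_of_rat \<gamma> < of_rat \<beta>" by (simp add: of_rat_less)
        then have "frac (of_rat \<gamma> - of_rat \<beta> :: real) = of_rat \<gamma> - of_rat \<beta> + 1"
          using o b0 g' by (intro frac_eq_add_one; linarith)
        \<comment> \<open>For \<open>t = 1\<close> strictness rests on
          \<open>\<gamma> \<noteq> 0\<close>, since 0 is then \<open>R\<close> itself.\<close>
        moreover have "real_of_rat t < 1 + of_rat \<gamma>"
        proof (cases "t = 1")
          case True
          then have "\<gamma> \<noteq> 0" using \<open>\<gamma> \<noteq> R\<close> t1 by (auto simp: R_def)
          then have "0 < real_of_rat \<gamma>" using g by simp
          then show ?thesis using True by simp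
        next
          case False
          then have "t < 1" using o' by simp
          then have "real_of_rat t < 1" by simp
          then show ?thesis using g' by linarith
        qed
        ultimately show ?thesis by simp
      qed
      then have "real_of_rat R \<in> arc_between (of_rat \<beta>) (of_rat \<gamma>)"
        unfolding arc_between_def using o fR
        by (intro CollectI exI[of _ "real_of_rat t - of_rat \<beta>"]) auto
      then show False using nin by blast
    qed
  qed
  then show ?thesis by (simp add: \<beta>_def R_def t_def)
qed

section \<open>The functions \<open>farey_fun\<close> as step functions\<close>

lemma sawtooth_diff:
  assumes "0 \<le> x" "x < 1" "0 \<le> y" "y \<le> 1" "x \<noteq> y" "y = 1 \<Longrightarrow> x \<noteq> 0"
  shows "sawtooth (x - y) = x - y + (if x < y then 1 / 2 else - 1 / 2)"
proof (cases "x < y")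
  case True
  then have "\<lfloor>x - y\<rfloor> = -1" using assms by (intro floor_unique) auto
  moreover have "x - y \<notin> \<int>"
  proof
    assume "x - y \<in> \<int>"
    then have "x - y = of_int \<lfloor>x - y\<rfloor>" by (auto elim!: Ints_cases)
    then show False using assms \<open>\<lfloor>x - y\<rfloor> = -1\<close> by auto
  qed
  ultimately show ?thesis using True by (simp add: sawtooth_def)
next
  case False
  then have "\<lfloor>x - y\<rfloor> = 0" using assms by (intro floor_unique) auto
  moreover have "x - y \<notin> \<int>"
  proof
    assume "x - y \<in> \<int>"
    then have "x - y = of_int \<lfloor>x - y\<rfloor>" by (auto elim!: Ints_cases)
    then show False using assms \<open>\<lfloor>x - y\<rfloor> = 0\<close> by auto
  qed
  ultimately show ?thesis using False by (simp add: sawtooth_def)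
qed

text \<open>Lets a right neighbour 0 be replaced by 1.\<close>

lemma sawtooth_minus_one: "sawtooth (x - 1) = sawtooth x"
proof -
  have "x - 1 \<in> \<int> \<longleftrightarrow> x \<in> \<int>"
    using Ints_add[of "x - 1" 1] Ints_diff[of x 1] by auto
  then show ?thesis by (simp add: sawtooth_def)
qed

text \<open>Weighted by the heights, the linear parts are \<open>(q + s) x - (p + r)\<close>,
  \<open>q x - p\<close> and \<open>s x - r\<close>; they cancel and only the jumps remain. At the
  three breakpoints a \<open>sawtooth\<close> takes its midpoint value 0, hence their
  exclusion.\<close>

lemma farey_fun_farey_pair:
  assumes fp: "farey_pair p q r s" and x: "0 < x" "x < 1"
    and ne: "x \<noteq> of_int p / of_int q" "x \<noteq> of_int (p + r) / of_int (q + s)" "x \<noteq> of_int r / of_int s"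
  shows "farey_fun (of_int (p + r) / of_int (q + s)) x =
    (if x < of_int p / of_int q then 0
     else if x < of_int (p + r) / of_int (q + s) then of_int q
     else if x < of_int r / of_int s then - of_int s else 0)"
proof -
  define \<beta> :: rat where "\<beta> = of_int (p + r) / of_int (q + s)"
  have *: "0 < q" "0 < s" "0 \<le> p" "r \<le> s" "r * q - p * s = 1" using fp by (auto simp: farey_pair_def)
  have rb: "of_rat \<beta> = real_of_int (p + r) / of_int (q + s)" by (simp add: \<beta>_def of_rat_divide of_rat_add)
  note o = farey_pair_order[OF fp]
  have "\<beta> \<noteq> 0" using o(1,2) rb by auto
  have h: "height \<beta> = nat (q + s)" "height (left_nbr \<beta>) = nat q" "height (right_nbr \<beta>) = nat s"
  proof -
    show "height \<beta> = nat (q + s)" "height (left_nbr \<beta>) = nat q"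
      using farey_pair_height[OF fp] left_nbr_farey_pair[OF fp] by (simp_all add: \<beta>_def)
    \<comment> \<open>A right end equal to 1 must be \<open>1/1\<close>, so the weight
      \<open>s\<close> agrees with the height of 0.\<close>
    have "s = 1" if "r = s"
    proof -
      have "s * (q - p) = 1" using that * by (simp add: algebra_simps)
      then have "s dvd 1" by (metis dvd_triv_left)
      then show ?thesis using * by simp
    qed
    then show "height (right_nbr \<beta>) = nat s"
      using farey_pair_height(2)[OF fp]
      unfolding \<beta>_def right_nbr_farey_pair[OF fp] by (cases "r = s") (simp_all add: height_0)
  qed
  have s1: "sawtooth (x - of_rat \<beta>) =
      x - of_int (p + r) / of_int (q + s) + (if x < of_int (p + r) / of_int (q + s) then 1 / 2 else - 1 / 2)"
    unfolding rb using o x ne by (intro sawtooth_diff; (linarith | simp))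
  have s2: "sawtooth (x - of_rat (left_nbr \<beta>)) =
      x - of_int p / of_int q + (if x < of_int p / of_int q then 1 / 2 else - 1 / 2)"
    unfolding \<beta>_def left_nbr_farey_pair[OF fp] of_rat_divide of_rat_of_int_eq
    using o x ne by (intro sawtooth_diff; (linarith | simp))
  have "sawtooth (x - of_rat (right_nbr \<beta>)) = sawtooth (x - of_int r / of_int s)"
    unfolding \<beta>_def right_nbr_farey_pair[OF fp]
    using * by (auto simp: of_rat_divide sawtooth_minus_one)
  also have "\<dots> = x - of_int r / of_int s + (if x < of_int r / of_int s then 1 / 2 else - 1 / 2)"
    using o x ne by (intro sawtooth_diff; (linarith | simp))
  finally have s3: "sawtooth (x - of_rat (right_nbr \<beta>)) =
    x - of_int r / of_int s + (if x < of_int r / of_int s then 1 / 2 else - 1 / 2)" .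
  have "farey_fun \<beta> x = of_int (q + s) * sawtooth (x - of_rat \<beta>)
      - of_int q * sawtooth (x - of_rat (left_nbr \<beta>)) - of_int s * sawtooth (x - of_rat (right_nbr \<beta>))"
    using \<open>\<beta> \<noteq> 0\<close> * by (simp add: farey_fun_def h)
  also have "\<dots> = (if x < of_int (p + r) / of_int (q + s) then of_int (q + s) / 2 else - of_int (q + s) / 2)
      - (if x < of_int p / of_int q then of_int q / 2 else - of_int q / 2)
      - (if x < of_int r / of_int s then of_int s / 2 else - of_int s / 2)"
  proof -
    have e: "of_int k * (x - of_int j / of_int k + (if P then 1 / 2 else - 1 / 2))
       = of_int k * x - of_int j + (if P then of_int k / 2 else - of_int k / 2)" if "k > 0" for k j P
      using that by (auto simp: field_simps)
    have pos: "q + s > 0" using * by simp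
    show ?thesis unfolding s1 s2 s3 e[OF pos] e[OF *(1)] e[OF *(2)]
      by (simp add: algebra_simps)
  qed
  also have "\<dots> = (if x < of_int p / of_int q then 0
     else if x < of_int (p + r) / of_int (q + s) then of_int q
     else if x < of_int r / of_int s then - of_int s else 0)"
    using less_trans[OF o(2,3)] o(2,3) by (simp only: of_int_add) argo
  finally show ?thesis by (simp add: \<beta>_def)
qed

lemma farey_pair_not_between:
  assumes fp: "farey_pair p q r s" and h: "int (height z) < q + s"
  shows "of_rat z \<le> real_of_int p / of_int q \<or> real_of_int r / of_int s \<le> of_rat z"
proof (rule ccontr)
  assume "\<not> ?thesis"
  then have "z = of_int (p + r) / of_int (q + s)"
    using farey_pair_between[OF fp, of z] h by auto
  then have "height z = nat (q + s)" using farey_pair_height(3)[OF fp] by simp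
  then show False using h fp by (simp add: farey_pair_def)
qed

text \<open>The breakpoints of \<open>farey_fun \<gamma>\<close> have height at most
  \<open>j\<close>, less than that of the mediant, so none lies inside the pair. This makes earlier
  terms constant on the support of a later one.\<close>

lemma farey_fun_constant_between:
  assumes fp: "farey_pair p q r s" and \<gamma>: "\<gamma> \<in> farey j" and j: "int j < q + s"
    and x: "x \<in> {real_of_int p / of_int q<..<of_int r / of_int s}"
    and y: "y \<in> {real_of_int p / of_int q<..<of_int r / of_int s}"
  shows "farey_fun \<gamma> x = farey_fun \<gamma> y"
proof (cases "\<gamma> = 0")
  case True
  then show ?thesis by (simp add: farey_fun_def)
next
  case False
  then have "0 < \<gamma>" "\<gamma> < 1" "height \<gamma> \<le> j" using \<gamma> by (auto simp: farey_def)
  then obtain p1 q1 r1 s1 where fp1: "farey_pair p1 q1 r1 s1" "\<gamma> = of_int (p1 + r1) / of_int (q1 + s1)"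
    "int (height \<gamma>) = q1 + s1" using farey_pair_exists by blast
  have *: "0 < q1" "0 < s1" using fp1 by (auto simp: farey_pair_def)
  have lt: "q1 + s1 < q + s" using fp1 \<open>height \<gamma> \<le> j\<close> j by linarith
  define L M R where "L = real_of_int p1 / of_int q1" and
    "M = real_of_int (p1 + r1) / of_int (q1 + s1)" and "R = real_of_int r1 / of_int s1"
  have L: "L \<le> real_of_int p / of_int q \<or> real_of_int r / of_int s \<le> L"
    using farey_pair_not_between[OF fp, of "of_int p1 / of_int q1"] farey_pair_height(1)[OF fp1(1)] lt *
    by (simp add: L_def of_rat_divide)
  have M: "M \<le> real_of_int p / of_int q \<or> real_of_int r / of_int s \<le> M"
    using farey_pair_not_between[OF fp, of \<gamma>] fp1 lt
    by (simp add: M_def of_rat_divide of_rat_add)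
  have R: "R \<le> real_of_int p / of_int q \<or> real_of_int r / of_int s \<le> R"
    using farey_pair_not_between[OF fp, of "of_int r1 / of_int s1"] farey_pair_height(2)[OF fp1(1)] lt *
    by (simp add: R_def of_rat_divide)
  have val: "farey_fun \<gamma> z = (if z < L then 0 else if z < M then of_int q1 else if z < R then - of_int s1 else 0)"
    if "z \<in> {real_of_int p / of_int q<..<of_int r / of_int s}" for z
    unfolding fp1(2) L_def M_def R_def
  proof (rule farey_fun_farey_pair[OF fp1(1)])
    show "0 < z" "z < 1" using that farey_pair_order[OF fp] by auto
    show "z \<noteq> of_int p1 / of_int q1" using that L by (auto simp: L_def)
    show "z \<noteq> of_int (p1 + r1) / of_int (q1 + s1)" using that M unfolding M_def by auto
    show "z \<noteq> of_int r1 / of_int s1" using that R by (auto simp: R_def)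
  qed
  have "x < L \<longleftrightarrow> y < L" using L x y by auto
  moreover have "x < M \<longleftrightarrow> y < M" using M x y by auto
  moreover have "x < R \<longleftrightarrow> y < R" using R x y by auto
  ultimately show ?thesis by (simp only: val[OF x] val[OF y])
qed

section \<open>Farey sums as a martingale\<close>

lemma sawtooth_measurable[measurable]: "sawtooth \<in> borel_measurable borel"
proof -
  have [measurable]: "(\<int> :: real set) \<in> sets borel"
    by (rule borel_closed) (rule closed_Ints)
  show ?thesis unfolding sawtooth_def[abs_def] by measurable
qed

lemma abs_sawtooth_le: "\<bar>sawtooth x\<bar> \<le> 1 / 2"
proof (cases "x \<in> \<int>")
  case False
  have "0 \<le> x - of_int \<lfloor>x\<rfloor>" "x - of_int \<lfloor>x\<rfloor> \<le> 1" by linarith+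
  then show ?thesis using False unfolding sawtooth_def by (simp only: if_False)
qed (simp add: sawtooth_def)

lemma farey_fun_measurable[measurable]: "farey_fun \<beta> \<in> borel_measurable borel"
  unfolding farey_fun_def[abs_def] by measurable

abbreviation unit_lborel :: "real measure" where
  "unit_lborel \<equiv> restrict_space lborel {0..<1}"

lemma finite_measure_unit_lborel: "finite_measure unit_lborel"
  by (rule finite_measureI) (simp add: emeasure_restrict_space space_restrict_space)

lemma measurable_unit_lborel: "f \<in> borel_measurable borel \<Longrightarrow> f \<in> borel_measurable unit_lborel"
  by (simp add: measurable_restrict_space1)

lemma integrable_farey_fun: "integrable unit_lborel (farey_fun \<beta>)"
proof -
  note finite = finite_measure_unit_lborel
  have "integrable unit_lborel (\<lambda>x. sawtooth (x - a))" for a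
  proof (rule finite_measure.integrable_const_bound[OF finite])
    show "AE x in unit_lborel. norm (sawtooth (x - a)) \<le> 1 / 2"
      unfolding real_norm_def by (rule AE_I2) (rule abs_sawtooth_le)
    show "(\<lambda>x. sawtooth (x - a)) \<in> borel_measurable unit_lborel"
      by (rule measurable_unit_lborel) measurable
  qed
  then show ?thesis
    unfolding farey_fun_def[abs_def]
    by (cases "\<beta> = 0") (auto intro: finite_measure.integrable_const[OF finite])
qed

text \<open>The set \<open>A\<close> contributes only a constant factor. The steps \<open>q\<close>
  and \<open>- s\<close> have lengths \<open>1/(q (q + s))\<close> and \<open>1/(s (q + s))\<close>,
  so their areas cancel.\<close>

lemma integral_farey_fun_eq_0:
  assumes fp: "farey_pair p q r s" and A: "A \<in> sets unit_lborel"
    and const: "\<And>x y. x \<in> {real_of_int p / of_int q<..<of_int r / of_int s} \<Longrightarrow>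
      y \<in> {real_of_int p / of_int q<..<of_int r / of_int s} \<Longrightarrow> x \<in> A \<longleftrightarrow> y \<in> A"
  shows "(\<integral>x. indicator A x * farey_fun (of_int (p + r) / of_int (q + s)) x \<partial>unit_lborel) = 0"
proof -
  define L M R where "L = real_of_int p / of_int q" and
    "M = real_of_int (p + r) / of_int (q + s)" and "R = real_of_int r / of_int s"
  have *: "0 < q" "0 < s" using fp by (auto simp: farey_pair_def)
  note o = farey_pair_order[OF fp, folded L_def M_def R_def]
  have [measurable]: "A \<in> sets borel" using A by (auto simp: sets_restrict_space)
  \<comment> \<open>\<open>M\<close> is a sample point: by \<open>const\<close>, membership in
    \<open>A\<close> is the same throughout the pair.\<close>
  define v :: real where "v = indicator A M"
  have v: "indicator A x = v" if "x \<in> {L<..<R}" for x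
    using const[of x M] that o by (auto simp: v_def indicator_def L_def[symmetric] R_def[symmetric])
  define g where "g x = v * (of_int q * indicator {L<..<M} x - of_int s * indicator {M<..<R} x)" for x :: real
  have "(\<integral>x. indicator A x * farey_fun (of_int (p + r) / of_int (q + s)) x \<partial>unit_lborel)
      = (\<integral>x. indicator {0..<1} x *\<^sub>R (indicator A x * farey_fun (of_int (p + r) / of_int (q + s)) x) \<partial>lborel)"
    by (subst integral_restrict_space) auto
  also have "\<dots> = (\<integral>x. g x \<partial>lborel)"
  proof (rule integral_cong_AE)
    have "AE x in lborel. x \<notin> {0, L, M, R}"
      by (intro AE_not_in countable_imp_null_set_lborel) auto
    then show "AE x in lborel. indicator {0..<1} x *\<^sub>R
        (indicator A x * farey_fun (of_int (p + r) / of_int (q + s)) x) = g x"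
    proof eventually_elim
      case (elim x)
      show ?case
      proof (cases "0 < x \<and> x < 1")
        case True
        then have val: "farey_fun (of_int (p + r) / of_int (q + s)) x =
            (if x < L then 0 else if x < M then of_int q else if x < R then - of_int s else 0)"
          unfolding L_def M_def R_def using elim
          by (intro farey_fun_farey_pair[OF fp]) (auto simp: L_def M_def R_def)
        consider "x < L" | "L < x" "x < M" | "M < x" "x < R" | "R < x"
          using elim by force
        then show ?thesis
          unfolding val by cases (use True o v[of x] in \<open>simp_all add: g_def indicator_def\<close>)
      next
        case False
        then have "x \<notin> {0..<1}" using elim by auto
        moreover have "\<not> (L < x \<and> x < M)" "\<not> (M < x \<and> x < R)" using False o by linarith+
        then have "x \<notin> {L<..<M}" "x \<notin> {M<..<R}" by simp_all
        ultimately show ?thesis by (simp add: g_def)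
      qed
    qed
  qed (auto simp: g_def[abs_def])
  also have "\<dots> = v * (of_int q * (M - L) - of_int s * (R - M))"
    using o by (simp add: g_def[abs_def])
  also have "of_int q * (M - L) - of_int s * (R - M) = of_int (q + s) * M - of_int q * L - of_int s * R"
    by (simp add: algebra_simps)
  also have "\<dots> = 0" using * by (simp add: L_def M_def R_def)
  finally show ?thesis by simp
qed

lemma farey_mono: "Q \<le> Q' \<Longrightarrow> farey Q \<subseteq> farey Q'"
  by (auto simp: farey_def)

text \<open>Time \<open>n\<close> of the martingale is the sum at height \<open>n + 1\<close>. The
  next increment combines functions \<open>farey_fun \<beta>\<close> with \<open>\<beta>\<close> of
  height exactly \<open>n + 2\<close>; each has mean zero and is supported where all earlier sums
  are constant.\<close>

theorem farey_sum_AE_convergent: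
  assumes bound: "\<And>n. (\<integral>x. \<bar>farey_sum c (Suc n) x\<bar> \<partial>unit_lborel) \<le> K"
  shows "\<exists>F. integrable unit_lborel F \<and>
    (AE x in unit_lborel. (\<lambda>n. farey_sum c (Suc n) x) \<longlonglongrightarrow> F x)"
proof (rule martingale_convergence)
  show "finite_measure unit_lborel" by (rule finite_measure_unit_lborel)
  show "integrable unit_lborel (farey_sum c (Suc n))" for n
    unfolding farey_sum_def[abs_def] by (auto intro!: integrable_farey_fun)
  show "(\<integral>x. \<bar>farey_sum c (Suc n) x\<bar> \<partial>unit_lborel) \<le> K" for n by (rule bound)
  fix n A
  assume A: "A \<in> sets unit_lborel"
    and sat: "\<And>x y. x \<in> space unit_lborel \<Longrightarrow> y \<in> space unit_lborel \<Longrightarrow>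
      (\<And>i. i \<le> n \<Longrightarrow> farey_sum c (Suc i) x = farey_sum c (Suc i) y) \<Longrightarrow> x \<in> A \<longleftrightarrow> y \<in> A"
  define D where "D = farey (Suc (Suc n)) - farey (Suc n)"
  have diff: "farey_sum c (Suc (Suc n)) x - farey_sum c (Suc n) x = (\<Sum>\<beta>\<in>D. c \<beta> * farey_fun \<beta> x)" for x
    unfolding farey_sum_def D_def using farey_mono[of "Suc n" "Suc (Suc n)"] finite_farey
    by (simp add: sum_diff)
  have "(\<integral>x. indicator A x * (farey_sum c (Suc (Suc n)) x - farey_sum c (Suc n) x) \<partial>unit_lborel)
      = (\<integral>x. (\<Sum>\<beta>\<in>D. c \<beta> * (indicator A x * farey_fun \<beta> x)) \<partial>unit_lborel)"
    unfolding diff by (simp add: sum_distrib_left algebra_simps)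
  also have "\<dots> = (\<Sum>\<beta>\<in>D. c \<beta> * (\<integral>x. indicator A x * farey_fun \<beta> x \<partial>unit_lborel))"
  proof (subst Bochner_Integration.integral_sum)
    show "integrable unit_lborel (\<lambda>x. c \<beta> * (indicator A x * farey_fun \<beta> x))" for \<beta>
      using integrable_mult_indicator[OF A integrable_farey_fun[of \<beta>]] by simp
  qed simp
  also have "\<dots> = 0"
  proof (rule sum.neutral, intro ballI)
    fix \<beta> assume "\<beta> \<in> D"
    then have \<beta>: "height \<beta> = Suc (Suc n)" "0 \<le> \<beta>" "\<beta> < 1" by (auto simp: D_def farey_def)
    \<comment> \<open>The point 0 has height 1, so it does not occur in an increment.\<close>
    then have "0 < \<beta>" using height_0 by (cases "\<beta> = 0") auto
    then obtain p q r s where fp: "farey_pair p q r s" "\<beta> = of_int (p + r) / of_int (q + s)"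
      "int (height \<beta>) = q + s" using \<beta> farey_pair_exists by blast
    have "(\<integral>x. indicator A x * farey_fun \<beta> x \<partial>unit_lborel) = 0"
      unfolding fp(2)
    proof (rule integral_farey_fun_eq_0[OF fp(1) A])
      fix x y assume xy: "x \<in> {real_of_int p / of_int q<..<of_int r / of_int s}"
        "y \<in> {real_of_int p / of_int q<..<of_int r / of_int s}"
      show "x \<in> A \<longleftrightarrow> y \<in> A"
      \<comment> \<open>Both points lie inside the pair, where every sum up to height
        \<open>n + 1 < q + s\<close> takes a single value, so \<open>A\<close> cannot separate
        them.\<close>
      proof (rule sat)
        show "x \<in> space unit_lborel" "y \<in> space unit_lborel"
          using xy farey_pair_order[OF fp(1)] by (auto simp: space_restrict_space)
        show "farey_sum c (Suc i) x = farey_sum c (Suc i) y" if "i \<le> n" for i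
          unfolding farey_sum_def
          using that \<beta>(1) fp(3)
          by (intro sum.cong refl arg_cong2[where f = "(*)"] farey_fun_constant_between[OF fp(1) _ _ xy]) auto
      qed
    qed
    then show "c \<beta> * (\<integral>x. indicator A x * farey_fun \<beta> x \<partial>unit_lborel) = 0" by simp
  qed
  finally show "(\<integral>x. indicator A x * (farey_sum c (Suc (Suc n)) x - farey_sum c (Suc n) x) \<partial>unit_lborel) = 0" .
qed

section \<open>Semiconvergents\<close>

text \<open>The position of \<open>\<alpha>\<close> gives \<open>r > 0\<close> and
  \<open>p < q\<close>. Then \<open>p * s = r * q - 1 \<ge> 0\<close>, and \<open>r > s\<close>
  would make the determinant at least \<open>q + s\<close>.\<close>

lemma farey_pair_around:
  fixes \<alpha> :: real
  assumes "0 < q" "0 < s" "r * q - p * s = 1" "0 < \<alpha>" "\<alpha> < 1"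
    and "real_of_int p / of_int q < \<alpha>" "\<alpha> < of_int r / of_int s"
  shows "farey_pair p q r s"
proof -
  have "real_of_int p / of_int q < 1" "0 < real_of_int r / of_int s" using assms by linarith+
  then have pq: "p < q" and r0: "0 < r" using assms(1,2) by (simp_all add: zero_less_divide_iff)
  have "0 < r * q" using r0 assms(1) by simp
  then have "0 \<le> p * s" using assms(3) by linarith
  then have "0 \<le> p" using assms(2) by (simp add: zero_le_mult_iff)
  moreover have "r \<le> s"
  proof (rule ccontr)
    assume "\<not> r \<le> s"
    then have "(s + 1) * q \<le> r * q" using assms(1) by (intro mult_right_mono) auto
    moreover have "p * s \<le> (q - 1) * s" using pq assms(2) by (intro mult_right_mono) auto
    ultimately show False using assms(1-3) by (simp add: algebra_simps)
  qed
  ultimately show ?thesis using assms by (simp add: farey_pair_def)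
qed

text \<open>A fraction whose function does not vanish at \<open>\<alpha>\<close> has its two parents on either side of
  \<open>\<alpha>\<close>; if it is higher than both ends of the pair around \<open>\<alpha>\<close>, its parents lie within that pair.\<close>

lemma farey_sum_mediant:
  assumes fp: "farey_pair p q r s" and \<alpha>: "\<alpha> \<notin> \<rat>"
    and lt: "real_of_int p / of_int q < \<alpha>" "\<alpha> < real_of_int r / of_int s"
  defines "\<beta> \<equiv> of_int (p + r) / of_int (q + s)"
  shows "farey_sum c (nat (q + s)) \<alpha> = farey_sum c (nat (max q s)) \<alpha> +
    c \<beta> * (if \<alpha> < real_of_int (p + r) / of_int (q + s) then of_int q else - of_int s)"
proof -
  have *: "0 < q" "0 < s" using fp by (auto simp: farey_pair_def)
  have irr: "\<alpha> \<noteq> real_of_int a / of_int b" for a b using \<alpha> by auto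
  have \<alpha>01: "0 < \<alpha>" "\<alpha> < 1" using farey_pair_order[OF fp] lt by linarith+
  define D where "D = farey (nat (q + s)) - farey (nat (max q s))"
  have h: "height \<beta> = nat (q + s)" using farey_pair_height[OF fp] by (simp add: \<beta>_def)
  have rb: "real_of_rat \<beta> = of_int (p + r) / of_int (q + s)" by (simp add: \<beta>_def of_rat_divide of_rat_add)
  have "0 \<le> real_of_rat \<beta>" "real_of_rat \<beta> < 1"
    using farey_pair_order[OF fp] unfolding rb by linarith+
  then have "\<beta> \<in> D" using h * by (auto simp: D_def farey_def)
  have zero: "farey_fun \<gamma> \<alpha> = 0" if \<gamma>: "\<gamma> \<in> D - {\<beta>}" for \<gamma>
  proof (rule ccontr)
    assume nz: "farey_fun \<gamma> \<alpha> \<noteq> 0"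
    have g: "0 \<le> \<gamma>" "\<gamma> < 1" "\<gamma> \<noteq> \<beta>" "height \<gamma> \<le> nat (q + s)" "\<not> height \<gamma> \<le> nat (max q s)"
      using \<gamma> unfolding D_def farey_def by auto
    then have g': "int (height \<gamma>) \<le> q + s" "max q s < int (height \<gamma>)" using * by linarith+
    have "\<gamma> \<noteq> 0"
    proof
      assume "\<gamma> = 0"
      then show False using g'(2) * height_0 by simp
    qed
    with g have "0 < \<gamma>" by simp
    then obtain p1 q1 r1 s1 where fp1: "farey_pair p1 q1 r1 s1" "\<gamma> = of_int (p1 + r1) / of_int (q1 + s1)"
      "int (height \<gamma>) = q1 + s1" using g farey_pair_exists by blast
    have rg: "real_of_rat \<gamma> = of_int (p1 + r1) / of_int (q1 + s1)"
      by (simp add: fp1(2) of_rat_divide of_rat_add)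
    have "\<not> \<alpha> < of_int p1 / of_int q1" "\<alpha> < of_int r1 / of_int s1"
      using nz farey_fun_farey_pair[OF fp1(1) \<alpha>01 irr irr irr] farey_pair_order(3)[OF fp1(1)]
      unfolding fp1(2) by (auto split: if_splits)
    then have a1: "of_int p1 / of_int q1 < \<alpha>" "\<alpha> < of_int r1 / of_int s1"
      using irr[of p1 q1] by linarith+
    \<comment> \<open>Each end of the given pair is lower than \<open>\<gamma>\<close>, so neither
      lies strictly between the parents of \<open>\<gamma>\<close>.\<close>
    have "of_int p / of_int q \<le> real_of_int p1 / of_int q1"
      using farey_pair_not_between[OF fp1(1), of "of_int p / of_int q"] farey_pair_height(1)[OF fp]
        * g'(2) fp1(3) a1 lt by (auto simp: of_rat_divide)
    moreover have "of_int r1 / of_int s1 \<le> real_of_int r / of_int s"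
      using farey_pair_not_between[OF fp1(1), of "of_int r / of_int s"] farey_pair_height(2)[OF fp]
        * g'(2) fp1(3) a1 lt by (auto simp: of_rat_divide)
    ultimately have "\<gamma> = \<beta>"
      unfolding \<beta>_def using farey_pair_order[OF fp1(1)] g'(1)
      by (intro farey_pair_between[OF fp]) (unfold rg, linarith+)
    with g show False by simp
  qed
  have "farey_sum c (nat (q + s)) \<alpha> - farey_sum c (nat (max q s)) \<alpha> = (\<Sum>\<gamma>\<in>D. c \<gamma> * farey_fun \<gamma> \<alpha>)"
    unfolding farey_sum_def D_def using farey_mono[of "nat (max q s)" "nat (q + s)"] finite_farey *
    by (simp add: sum_diff)
  also have "\<dots> = (\<Sum>\<gamma>\<in>{\<beta>}. c \<gamma> * farey_fun \<gamma> \<alpha>)"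
    using zero \<open>\<beta> \<in> D\<close> finite_farey by (intro sum.mono_neutral_right) (auto simp: D_def)
  also have "\<dots> = c \<beta> * (if \<alpha> < of_int (p + r) / of_int (q + s) then of_int q else - of_int s)"
    using farey_fun_farey_pair[OF fp \<alpha>01 irr irr irr] lt by (simp add: \<beta>_def)
  finally show ?thesis by simp
qed

section \<open>Continued fraction errors and denominators\<close>

definition unit_irrational :: "real \<Rightarrow> bool" where
  "unit_irrational \<alpha> \<longleftrightarrow> 0 < \<alpha> \<and> \<alpha> < 1 \<and> \<alpha> \<notin> \<rat>"

lemma unit_irrationalD:
  assumes "unit_irrational \<alpha>"
  shows "0 < \<alpha>" "\<alpha> < 1" "\<alpha> \<notin> \<rat>"
  using assms by (simp_all add: unit_irrational_def)

text \<open>The signed error \<open>\<alpha> * q_(k-2) - p_(k-2)\<close>, which obeys the same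
  recurrence as numerators and denominators.\<close>

definition cf_err :: "real \<Rightarrow> nat \<Rightarrow> real" where
  "cf_err \<alpha> k = \<alpha> * of_int (cf_den_shift \<alpha> k) - of_int (cf_num_shift \<alpha> k)"

lemma cf_complete_irrational:
  assumes irr: "unit_irrational \<alpha>"
  shows "cf_complete \<alpha> k \<notin> \<rat>"
proof (induction k)
  case (Suc k)
  show ?case
  proof
    assume "cf_complete \<alpha> (Suc k) \<in> \<rat>"
    then have "frac (cf_complete \<alpha> k) \<in> \<rat>"
      using Rats_divide[OF Rats_1] by fastforce
    then have "frac (cf_complete \<alpha> k) + of_int \<lfloor>cf_complete \<alpha> k\<rfloor> \<in> \<rat>"
      by (intro Rats_add) auto
    then show False using Suc by (simp add: frac_def)
  qed
qed (simp add: unit_irrationalD(3)[OF irr])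

lemma frac_cf_complete:
  assumes irr: "unit_irrational \<alpha>"
  shows "0 < frac (cf_complete \<alpha> k)" "frac (cf_complete \<alpha> k) < 1"
proof -
  have "cf_complete \<alpha> k \<notin> \<int>" using cf_complete_irrational[OF irr] Ints_subset_Rats by blast
  then show "0 < frac (cf_complete \<alpha> k)" by (simp add: frac_gt_0_iff)
qed (simp add: frac_lt_1)

lemma cf_digit_0:
  assumes irr: "unit_irrational \<alpha>"
  shows "cf_digit \<alpha> 0 = 0"
  using unit_irrationalD(1)[OF irr] unit_irrationalD(2)[OF irr] by (simp add: cf_digit_def floor_eq_iff)

lemma cf_digit_ge_1:
  assumes irr: "unit_irrational \<alpha>"
  shows "1 \<le> cf_digit \<alpha> (Suc k)"
  using frac_cf_complete[OF irr, of k] by (simp add: cf_digit_def le_floor_iff)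

lemma cf_digit_less:
  assumes irr: "unit_irrational \<alpha>"
  shows "of_int (cf_digit \<alpha> k) < cf_complete \<alpha> k"
  using frac_cf_complete(1)[OF irr, of k] by (simp add: cf_digit_def frac_def)

text \<open>If it holds at \<open>k\<close>, the recurrence makes the next error
  \<open>- frac (cf_complete \<alpha> k)\<close> times \<open>cf_err \<alpha> (Suc k)\<close>, and
  the next complete quotient is the reciprocal of that fractional part.\<close>

lemma cf_complete_mult_err:
  assumes irr: "unit_irrational \<alpha>"
  shows "cf_complete \<alpha> k * cf_err \<alpha> (Suc k) = - cf_err \<alpha> k"
proof (induction k)
  case (Suc k)
  have "cf_err \<alpha> (Suc (Suc k)) = of_int (cf_digit \<alpha> k) * cf_err \<alpha> (Suc k) + cf_err \<alpha> k"
    by (simp add: cf_err_def algebra_simps)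
  also have "\<dots> = - frac (cf_complete \<alpha> k) * cf_err \<alpha> (Suc k)"
    using Suc by (simp add: cf_digit_def frac_def algebra_simps)
  finally show ?case using frac_cf_complete(1)[OF irr, of k] by simp
qed (simp add: cf_err_def)

text \<open>Complete quotients are positive, so consecutive errors have opposite signs, starting
  from \<open>cf_err \<alpha> 0 = \<alpha>\<close>.\<close>

lemma cf_err_sign:
  assumes irr: "unit_irrational \<alpha>"
  shows "0 < (- 1) ^ k * cf_err \<alpha> k"
proof (induction k)
  case (Suc k)
  have "0 < cf_complete \<alpha> k"
    using frac_cf_complete(1)[OF irr, of "k - 1"] unit_irrationalD(1)[OF irr] by (cases k) auto
  moreover have "(- 1) ^ k * cf_err \<alpha> k = cf_complete \<alpha> k * ((- 1) ^ Suc k * cf_err \<alpha> (Suc k))"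
    using arg_cong[OF cf_complete_mult_err[OF irr, of k], of "\<lambda>x. (- 1) ^ Suc k * x"] by (simp add: mult.left_commute)
  ultimately show ?case using Suc by (metis zero_less_mult_pos)
qed (simp add: cf_err_def unit_irrationalD(1)[OF irr])

lemma cf_det: "cf_num_shift \<alpha> (Suc k) * cf_den_shift \<alpha> k - cf_num_shift \<alpha> k * cf_den_shift \<alpha> (Suc k) = (- 1) ^ k"
  by (induction k) (auto simp: algebra_simps)

lemma cf_den_shift_pos:
  assumes irr: "unit_irrational \<alpha>"
  shows "0 < cf_den_shift \<alpha> (Suc (Suc k))"
proof -
  \<comment> \<open>The preceding denominator is only nonnegative at the start, since
    \<open>q_(-1) = 0\<close>.\<close>
  have "0 < cf_den_shift \<alpha> (Suc (Suc k)) \<and> 0 \<le> cf_den_shift \<alpha> (Suc k)"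
  proof (induction k)
    case (Suc k)
    have "0 < cf_digit \<alpha> (Suc k) * cf_den_shift \<alpha> (Suc (Suc k))" using Suc cf_digit_ge_1[OF irr, of k] by simp
    then show ?case using Suc by simp
  qed (simp add: cf_digit_0[OF irr])
  then show ?thesis by simp
qed

lemma cf_den_shift_nonneg:
  assumes irr: "unit_irrational \<alpha>"
  shows "0 \<le> cf_den_shift \<alpha> k"
proof (cases k)
  case (Suc j)
  then show ?thesis using cf_den_shift_pos[OF irr, of "j - 1"] by (cases j) auto
qed simp

lemma cf_den_shift_step:
  assumes irr: "unit_irrational \<alpha>"
  shows "cf_den_shift \<alpha> (Suc (Suc k)) + cf_den_shift \<alpha> (Suc k) \<le> cf_den_shift \<alpha> (Suc (Suc (Suc k)))"
proof -
  have "1 * cf_den_shift \<alpha> (Suc (Suc k)) \<le> cf_digit \<alpha> (Suc k) * cf_den_shift \<alpha> (Suc (Suc k))"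
    by (rule mult_right_mono[OF cf_digit_ge_1[OF irr] cf_den_shift_nonneg[OF irr]])
  then show ?thesis by simp
qed

text \<open>Linear growth is enough to send the heights \<open>q_N\<close> to infinity.\<close>

lemma cf_den_shift_ge:
  assumes irr: "unit_irrational \<alpha>"
  shows "int k \<le> cf_den_shift \<alpha> (Suc (Suc k))"
proof (induction k)
  case (Suc k)
  note IH = Suc
  show ?case
  proof (cases k)
    \<comment> \<open>Here \<open>q_(-1) = 0\<close> gives no increment, so positivity of
      \<open>q_1\<close> is used instead.\<close>
    case 0
    then show ?thesis using cf_den_shift_pos[OF irr, of "Suc 0"] by (simp del: cf_den_shift.simps)
  next
    case (Suc j)
    then show ?thesis using IH cf_den_shift_step[OF irr, of k] cf_den_shift_pos[OF irr, of j] by (simp del: cf_den_shift.simps)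
  qed
qed (use cf_den_shift_pos[OF irr, of 0] in simp)

text \<open>\<open>semi_num \<alpha> k m / semi_den \<alpha> k m\<close>, for \<open>1 \<le> m \<le> a\<^bsub>k+1\<^esub>\<close>, are the elements of \<open>E\<^bsub>k+1\<^esub>\<close>
  before reduction modulo 1. Each is the mediant of its predecessor and \<open>p\<^sub>k / q\<^sub>k\<close>.\<close>

definition semi_num :: "real \<Rightarrow> nat \<Rightarrow> int \<Rightarrow> int" where
  "semi_num \<alpha> k m = m * cf_num_shift \<alpha> (Suc (Suc k)) + cf_num_shift \<alpha> (Suc k)"

definition semi_den :: "real \<Rightarrow> nat \<Rightarrow> int \<Rightarrow> int" where
  "semi_den \<alpha> k m = m * cf_den_shift \<alpha> (Suc (Suc k)) + cf_den_shift \<alpha> (Suc k)"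

section \<open>Semiconvergents as iterated mediants\<close>

lemma semiconvergents_Suc:
  "semiconvergents \<alpha> (Suc k) = (\<lambda>m. frac (of_int (semi_num \<alpha> k m) / of_int (semi_den \<alpha> k m))) ` {1..cf_digit \<alpha> (Suc k)}"
proof -
  have "nat (int (Suc k) - 1 + 2) = Suc (Suc k)" "nat (int (Suc k) - 2 + 2) = Suc k" by auto
  then show ?thesis
    unfolding semiconvergents_def cf_num_def cf_den_def semi_num_def semi_den_def by auto
qed

text \<open>The error is \<open>m - cf_complete \<alpha> (Suc k)\<close> times that of
  \<open>p_k/q_k\<close>, and \<open>m\<close> stays below the complete quotient. So the
  semiconvergent lies on the other side of \<open>\<alpha>\<close> from
  \<open>p_k/q_k\<close>.\<close>

lemma semi_den_err_sign:
  assumes irr: "unit_irrational \<alpha>" and "m \<le> cf_digit \<alpha> (Suc k)"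
  shows "(- 1) ^ k * (\<alpha> * of_int (semi_den \<alpha> k m) - of_int (semi_num \<alpha> k m)) < 0"
proof -
  have "\<alpha> * of_int (semi_den \<alpha> k m) - of_int (semi_num \<alpha> k m) = of_int m * cf_err \<alpha> (Suc (Suc k)) + cf_err \<alpha> (Suc k)"
    by (simp add: semi_den_def semi_num_def cf_err_def algebra_simps)
  also have "\<dots> = (of_int m - cf_complete \<alpha> (Suc k)) * cf_err \<alpha> (Suc (Suc k))"
    using cf_complete_mult_err[OF irr, of "Suc k"] by (simp add: algebra_simps)
  finally have "(- 1) ^ k * (\<alpha> * of_int (semi_den \<alpha> k m) - of_int (semi_num \<alpha> k m))
      = (of_int m - cf_complete \<alpha> (Suc k)) * ((- 1) ^ Suc (Suc k) * cf_err \<alpha> (Suc (Suc k)))"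
    by simp
  moreover have "of_int m < cf_complete \<alpha> (Suc k)"
    using assms cf_digit_less[OF irr, of "Suc k"] by linarith
  ultimately show ?thesis using cf_err_sign[OF irr, of "Suc (Suc k)"] by (simp only: mult_neg_pos)
qed

text \<open>\<open>p_k/q_k\<close> and the \<open>m\<close>-th semiconvergent form a Farey pair
  around \<open>\<alpha>\<close> whose mediant is the next semiconvergent. Thus
  \<open>\<alpha>\<close> lies between \<open>p_k/q_k\<close> and the mediant, where the step
  function is \<open>q_k\<close> or \<open>- q_k\<close> by the parity of \<open>k\<close>.
  Positivity of the denominator excludes \<open>k = m = 0\<close>, the fraction
  \<open>1/0\<close>.\<close>

lemma semiconvergent_step:
  assumes irr: "unit_irrational \<alpha>" and m: "0 \<le> m" "m < cf_digit \<alpha> (Suc k)" and den: "0 < semi_den \<alpha> k m"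
  defines "\<beta> \<equiv> frac (of_int (semi_num \<alpha> k (m + 1)) / of_int (semi_den \<alpha> k (m + 1)))"
  shows "height \<beta> = nat (semi_den \<alpha> k (m + 1))"
    "farey_sum c (nat (semi_den \<alpha> k (m + 1))) \<alpha> = farey_sum c (nat (max (cf_den_shift \<alpha> (Suc (Suc k))) (semi_den \<alpha> k m))) \<alpha>
       + (- 1) ^ k * of_int (cf_den_shift \<alpha> (Suc (Suc k))) * c \<beta>"
proof -
  define p q r s where "p = cf_num_shift \<alpha> (Suc (Suc k))" and "q = cf_den_shift \<alpha> (Suc (Suc k))" and "r = semi_num \<alpha> k m" and "s = semi_den \<alpha> k m"
  have q: "0 < q" and s: "0 < s" using cf_den_shift_pos[OF irr] den by (auto simp: q_def s_def)
  have med: "semi_num \<alpha> k (m + 1) = p + r" "semi_den \<alpha> k (m + 1) = q + s"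
    by (simp_all add: semi_num_def semi_den_def p_def q_def r_def s_def algebra_simps)
  have det: "r * q - p * s = (- 1) ^ k"
    using cf_det[of \<alpha> "Suc k"] by (simp add: semi_num_def semi_den_def p_def q_def r_def s_def algebra_simps)
  have e1: "0 < (- 1) ^ k * (\<alpha> * of_int q - of_int p)"
    using cf_err_sign[OF irr, of "Suc (Suc k)"] by (simp add: cf_err_def p_def q_def)
  have e2: "(- 1) ^ k * (\<alpha> * of_int s - of_int r) < 0"
    using semi_den_err_sign[OF irr, of m k] m by (simp add: r_def s_def)
  have e3: "(- 1) ^ k * (\<alpha> * of_int (q + s) - of_int (p + r)) < 0"
    using semi_den_err_sign[OF irr, of "m + 1" k] m by (simp add: med)
  \<comment> \<open>Mediants of Farey pairs already lie in \<open>[0,1)\<close>, so reduction modulo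
    1 changes nothing.\<close>
  have in01: "frac (of_int (p' + r') / of_int (q' + s')) = (of_int (p' + r') / of_int (q' + s') :: rat)"
    if "farey_pair p' q' r' s'" for p' q' r' s'
  proof -
    have "0 \<le> real_of_int (p' + r') / of_int (q' + s')" "real_of_int (p' + r') / of_int (q' + s') < 1"
      using farey_pair_order[OF that] by linarith+
    moreover have "real_of_int (p' + r') / of_int (q' + s') = real_of_rat (of_int (p' + r') / of_int (q' + s'))"
      by (simp add: of_rat_divide of_rat_add)
    ultimately show ?thesis by (simp only: frac_eq zero_le_of_rat_iff of_rat_less_1_iff)
  qed
  show "height \<beta> = nat (semi_den \<alpha> k (m + 1))"
    "farey_sum c (nat (semi_den \<alpha> k (m + 1))) \<alpha> = farey_sum c (nat (max (cf_den_shift \<alpha> (Suc (Suc k))) (semi_den \<alpha> k m))) \<alpha>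
       + (- 1) ^ k * of_int (cf_den_shift \<alpha> (Suc (Suc k))) * c \<beta>"
  proof (atomize (full), cases "even k")
    case True
    have lt: "real_of_int p / of_int q < \<alpha>" "\<alpha> < of_int r / of_int s"
      "\<alpha> < of_int (p + r) / of_int (q + s)"
      using True e1 e2 e3 q s by (simp_all add: field_simps)
    have fp: "farey_pair p q r s"
      using farey_pair_around[OF q s _ unit_irrationalD(1)[OF irr] unit_irrationalD(2)[OF irr] lt(1,2)] det True by simp
    show "height \<beta> = nat (semi_den \<alpha> k (m + 1)) \<and>
      farey_sum c (nat (semi_den \<alpha> k (m + 1))) \<alpha> = farey_sum c (nat (max (cf_den_shift \<alpha> (Suc (Suc k))) (semi_den \<alpha> k m))) \<alpha>
       + (- 1) ^ k * of_int (cf_den_shift \<alpha> (Suc (Suc k))) * c \<beta>"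
      using farey_sum_mediant[OF fp unit_irrationalD(3)[OF irr] lt(1,2), of c] lt(3) True farey_pair_height(3)[OF fp]
      unfolding \<beta>_def med in01[OF fp] q_def[symmetric] s_def[symmetric] by simp
  next
    \<comment> \<open>For odd \<open>k\<close> the ends change places: \<open>p_k/q_k\<close> is the
      right end, and the value is minus its height.\<close>
    case False
    have lt: "real_of_int r / of_int s < \<alpha>" "\<alpha> < of_int p / of_int q"
      "\<not> \<alpha> < of_int (r + p) / of_int (s + q)"
      using False e1 e2 e3 q s by (simp_all add: field_simps)
    have fp: "farey_pair r s p q"
      using farey_pair_around[OF s q _ unit_irrationalD(1)[OF irr] unit_irrationalD(2)[OF irr] lt(1,2)] det False by simp
    show "height \<beta> = nat (semi_den \<alpha> k (m + 1)) \<and>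
      farey_sum c (nat (semi_den \<alpha> k (m + 1))) \<alpha> = farey_sum c (nat (max (cf_den_shift \<alpha> (Suc (Suc k))) (semi_den \<alpha> k m))) \<alpha>
       + (- 1) ^ k * of_int (cf_den_shift \<alpha> (Suc (Suc k))) * c \<beta>"
      using farey_sum_mediant[OF fp unit_irrationalD(3)[OF irr] lt(1,2), of c] lt(3) False farey_pair_height(3)[OF fp]
      unfolding \<beta>_def med add.commute[of p r] add.commute[of q s] in01[OF fp]
        q_def[symmetric] s_def[symmetric] max.commute[of q s] by simp
  qed
qed

lemma semi_den_pos:
  assumes irr: "unit_irrational \<alpha>"
  shows "1 \<le> m \<or> 1 \<le> k \<and> 0 \<le> m \<Longrightarrow> 0 < semi_den \<alpha> k m"
proof -
  assume "1 \<le> m \<or> 1 \<le> k \<and> 0 \<le> m"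
  then show ?thesis
  proof
    assume "1 \<le> m"
    then have "0 < m * cf_den_shift \<alpha> (Suc (Suc k))" using cf_den_shift_pos[OF irr, of k] by simp
    then show ?thesis using cf_den_shift_nonneg[OF irr, of "Suc k"] by (simp add: semi_den_def)
  next
    assume m: "1 \<le> k \<and> 0 \<le> m"
    then have "0 < cf_den_shift \<alpha> (Suc k)" using cf_den_shift_pos[OF irr, of "k - 1"] by simp
    moreover have "0 \<le> m * cf_den_shift \<alpha> (Suc (Suc k))" using m cf_den_shift_nonneg[OF irr] by (intro mult_nonneg_nonneg) blast+
    ultimately show ?thesis by (simp add: semi_den_def)
  qed
qed

text \<open>Modulo 1 this is the point 0, the one element of the sets \<open>E_n\<close> that is not
  the mediant of a Farey pair; it needs separate treatment below.\<close>

lemma semi_den_0_1: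
  assumes irr: "unit_irrational \<alpha>"
  shows "semi_num \<alpha> 0 1 = 1" "semi_den \<alpha> 0 1 = 1"
  by (simp_all add: semi_num_def semi_den_def cf_digit_0[OF irr])

lemma height_semiconvergent:
  assumes irr: "unit_irrational \<alpha>" and "m \<in> {1..cf_digit \<alpha> (Suc k)}"
  shows "height (frac (of_int (semi_num \<alpha> k m) / of_int (semi_den \<alpha> k m))) = nat (semi_den \<alpha> k m)"
proof (cases "k = 0 \<and> m = 1")
  case True
  then show ?thesis by (auto simp: semi_den_0_1[OF irr] height_0)
next
  case False
  then have "0 < semi_den \<alpha> k (m - 1)" using assms by (intro semi_den_pos[OF irr]) auto
  then show ?thesis using semiconvergent_step(1)[OF irr, of "m - 1" k] assms by simp
qed

section \<open>Partial sums over semiconvergents as Farey sums\<close>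

text \<open>Distinct \<open>m\<close> give distinct heights, because the denominators grow by
  \<open>q_k > 0\<close>; summing over the set loses no term.\<close>

lemma sum_semiconvergents:
  assumes irr: "unit_irrational \<alpha>"
  shows "(\<Sum>\<beta>\<in>semiconvergents \<alpha> (Suc k). c \<beta>)
     = (\<Sum>m\<in>{1..cf_digit \<alpha> (Suc k)}. c (frac (of_int (semi_num \<alpha> k m) / of_int (semi_den \<alpha> k m))))"
  unfolding semiconvergents_Suc
proof (rule sum.reindex_cong[OF _ refl refl])
  show "inj_on (\<lambda>m. frac (of_int (semi_num \<alpha> k m) / of_int (semi_den \<alpha> k m)) :: rat) {1..cf_digit \<alpha> (Suc k)}"
  proof (rule inj_onI)
    fix m m' assume mm: "m \<in> {1..cf_digit \<alpha> (Suc k)}" "m' \<in> {1..cf_digit \<alpha> (Suc k)}"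
      and eq: "frac (of_int (semi_num \<alpha> k m) / of_int (semi_den \<alpha> k m)) = (frac (of_int (semi_num \<alpha> k m') / of_int (semi_den \<alpha> k m')) :: rat)"
    have "nat (semi_den \<alpha> k m) = nat (semi_den \<alpha> k m')"
      using arg_cong[OF eq, of height] mm by (simp add: height_semiconvergent[OF irr])
    moreover have "0 < semi_den \<alpha> k m" "0 < semi_den \<alpha> k m'" using mm by (auto intro!: semi_den_pos[OF irr])
    ultimately have "semi_den \<alpha> k m = semi_den \<alpha> k m'" by simp
    then show "m = m'" using cf_den_shift_pos[OF irr, of k] by (simp add: semi_den_def)
  qed
qed

text \<open>One mediant at a time along \<open>E_(k+1)\<close>. The maximum is \<open>q_k\<close> at
  \<open>j = 0\<close>, where \<open>semi_den\<close> is \<open>q_(k-1)\<close>, and the new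
  denominator afterwards. For \<open>k = 0\<close> the sum starts from 0, since the term of the
  point 0 is itself the first of \<open>E_1\<close>.\<close>

lemma farey_sum_semiconvergents:
  assumes irr: "unit_irrational \<alpha>" and "int j \<le> cf_digit \<alpha> (Suc k)" "1 \<le> k \<or> 1 \<le> j"
  shows "farey_sum c (nat (max (cf_den_shift \<alpha> (Suc (Suc k))) (semi_den \<alpha> k (int j)))) \<alpha> =
    (if k = 0 then 0 else farey_sum c (nat (cf_den_shift \<alpha> (Suc (Suc k)))) \<alpha>) +
    (- 1) ^ k * of_int (cf_den_shift \<alpha> (Suc (Suc k))) *
      (\<Sum>m\<in>{1..int j}. c (frac (of_int (semi_num \<alpha> k m) / of_int (semi_den \<alpha> k m))))"
  using assms(2,3)
proof (induction j)
  case 0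
  then obtain k' where k: "k = Suc k'" by (cases k) auto
  have "semi_den \<alpha> k 0 \<le> cf_den_shift \<alpha> (Suc (Suc k))"
    using cf_den_shift_step[OF irr, of k'] cf_den_shift_nonneg[OF irr, of "Suc k'"] by (simp add: semi_den_def k)
  then show ?case using k by (simp add: max_def)
next
  case (Suc j)
  show ?case
  proof (cases "k = 0 \<and> j = 0")
    case True
    \<comment> \<open>The sum at height 1 is therefore \<open>c 0\<close>, the contribution of
      \<open>1/1\<close>.\<close>
    have "farey 1 = {0}"
    proof -
      have "\<beta> = 0" if \<beta>: "\<beta> \<in> farey 1" for \<beta>
      proof (rule ccontr)
        assume "\<beta> \<noteq> 0"
        then have "0 < \<beta>" "\<beta> < 1" "height \<beta> \<le> 1" using \<beta> by (auto simp: farey_def)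
        obtain p q r s where "farey_pair p q r s" "int (height \<beta>) = q + s"
          by (rule farey_pair_exists[OF \<open>0 < \<beta>\<close> \<open>\<beta> < 1\<close>])
        then show False using \<open>height \<beta> \<le> 1\<close> by (auto simp: farey_pair_def)
      qed
      then show ?thesis by (auto simp: farey_def height_0)
    qed
    then show ?thesis
      using True semi_den_0_1[OF irr] by (simp add: cf_digit_0[OF irr] farey_sum_def farey_fun_def)
  next
    case False
    then have ge: "1 \<le> k \<or> 1 \<le> j" by auto
    have den: "0 < semi_den \<alpha> k (int j)" using ge by (intro semi_den_pos[OF irr]) auto
    note step = semiconvergent_step(2)[OF irr, of "int j" k c, OF _ _ den]
    have "cf_den_shift \<alpha> (Suc (Suc k)) \<le> semi_den \<alpha> k (int (Suc j))"
      using den by (simp add: semi_den_def algebra_simps del: cf_den_shift.simps)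
    then have mx: "max (cf_den_shift \<alpha> (Suc (Suc k))) (semi_den \<alpha> k (int (Suc j))) = semi_den \<alpha> k (int j + 1)" by (simp add: add.commute)
    have set: "{1..int (Suc j)} = insert (int j + 1) {1..int j}" by auto
    have j: "int j \<le> cf_digit \<alpha> (Suc k)" "int j < cf_digit \<alpha> (Suc k)" using Suc.prems by auto
    show ?thesis
      unfolding mx set step[OF of_nat_0_le_iff j(2)] Suc.IH[OF j(1) ge]
      by (simp add: distrib_left del: cf_den_shift.simps)
  qed
qed

text \<open>The last element of \<open>E_(k+1)\<close> has denominator \<open>q_(k+1)\<close>, so
  running through \<open>E_1, ..., E_N\<close> raises the height to \<open>q_N\<close>.\<close>

lemma farey_sum_den:
  assumes irr: "unit_irrational \<alpha>" and "1 \<le> N"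
  shows "farey_sum c (nat (cf_den_shift \<alpha> (Suc (Suc N)))) \<alpha> =
    (\<Sum>n=1..N. (- 1) ^ (n - 1) * real_of_int (cf_den \<alpha> (int n - 1)) * (\<Sum>\<beta>\<in>semiconvergents \<alpha> n. c \<beta>))"
proof -
  have digit: "farey_sum c (nat (cf_den_shift \<alpha> (Suc (Suc (Suc k))))) \<alpha> =
    (if k = 0 then 0 else farey_sum c (nat (cf_den_shift \<alpha> (Suc (Suc k)))) \<alpha>) +
    (- 1) ^ k * of_int (cf_den \<alpha> (int (Suc k) - 1)) * (\<Sum>\<beta>\<in>semiconvergents \<alpha> (Suc k). c \<beta>)" for k
  proof -
    define j where "j = nat (cf_digit \<alpha> (Suc k))"
    have j: "int j = cf_digit \<alpha> (Suc k)" "1 \<le> j" using cf_digit_ge_1[OF irr, of k] by (auto simp: j_def)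
    have "nat (int (Suc k) - 1 + 2) = Suc (Suc k)" by simp
    then have cd: "cf_den \<alpha> (int (Suc k) - 1) = cf_den_shift \<alpha> (Suc (Suc k))" unfolding cf_den_def by simp
    have "max (cf_den_shift \<alpha> (Suc (Suc k))) (semi_den \<alpha> k (int j)) = cf_den_shift \<alpha> (Suc (Suc (Suc k)))"
      using cf_den_shift_step[OF irr, of k] cf_den_shift_nonneg[OF irr, of "Suc k"] by (simp add: semi_den_def j(1))
    then show ?thesis
      using farey_sum_semiconvergents[OF irr, of j k c] j unfolding cd sum_semiconvergents[OF irr] by simp
  qed
  show ?thesis using assms(2)
  proof (induction N rule: dec_induct)
    case base
    show ?case using digit[of 0] by simp
  next
    case (step N)
    then show ?case using digit[of N] by simp
  qed
qed

lemma filterlim_cf_den_shift: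
  assumes irr: "unit_irrational \<alpha>"
  shows "filterlim (\<lambda>N. nat (cf_den_shift \<alpha> (Suc (Suc N)))) at_top sequentially"
proof (rule filterlim_at_top_mono[OF filterlim_ident])
  show "\<forall>\<^sub>F N in sequentially. N \<le> nat (cf_den_shift \<alpha> (Suc (Suc N)))"
    using cf_den_shift_ge[OF irr] by (intro always_eventually allI) (simp only: le_nat_iff cf_den_shift_nonneg[OF irr])
qed

text \<open>At an irrational \<open>\<alpha>\<close> the partial sums are the Farey sums at the
  heights \<open>q_N\<close>, which tend to infinity, so they inherit the almost everywhere
  limit.\<close>

lemma semiconvergent_series_AE_convergent:
  fixes c :: "rat \<Rightarrow> real"
  assumes bound: "\<And>Q. 1 \<le> Q \<Longrightarrow> (LBINT x:{0..<1}. \<bar>farey_sum c Q x\<bar>) \<le> K"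
  shows "\<exists>F :: real \<Rightarrow> real. set_integrable lborel {0..<1} F \<and>
    (AE \<alpha> in lborel. \<alpha> \<in> {0<..<1} \<and> \<alpha> \<notin> \<rat> \<longrightarrow>
      (\<lambda>N. \<Sum>n=1..N. (-1) ^ (n - 1) * real_of_int (cf_den \<alpha> (int n - 1)) *
              (\<Sum>\<beta>\<in>semiconvergents \<alpha> n. c \<beta>)) \<longlonglongrightarrow> F \<alpha>)"
proof -
  have "(\<integral>x. \<bar>farey_sum c (Suc n) x\<bar> \<partial>unit_lborel) \<le> K" for n
    using bound[of "Suc n"] by (simp add: integral_restrict_space set_lebesgue_integral_def)
  from farey_sum_AE_convergent[OF this] obtain F where F: "integrable unit_lborel F"
    "AE x in unit_lborel. (\<lambda>n. farey_sum c (Suc n) x) \<longlonglongrightarrow> F x" by blast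
  have "set_integrable lborel {0..<1} F"
    using F(1) by (simp add: integrable_restrict_space set_integrable_def)
  moreover have "AE \<alpha> in lborel. \<alpha> \<in> {0..<1} \<longrightarrow> (\<lambda>n. farey_sum c (Suc n) \<alpha>) \<longlonglongrightarrow> F \<alpha>"
    using F(2) by (simp add: AE_restrict_space_iff)
  then have "AE \<alpha> in lborel. \<alpha> \<in> {0<..<1} \<and> \<alpha> \<notin> \<rat> \<longrightarrow>
      (\<lambda>N. \<Sum>n=1..N. (-1) ^ (n - 1) * real_of_int (cf_den \<alpha> (int n - 1)) *
              (\<Sum>\<beta>\<in>semiconvergents \<alpha> n. c \<beta>)) \<longlonglongrightarrow> F \<alpha>"
  proof eventually_elim
    case (elim \<alpha>)
    show ?case
    proof
      assume \<alpha>: "\<alpha> \<in> {0<..<1} \<and> \<alpha> \<notin> \<rat>"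
      then have irr: "unit_irrational \<alpha>" by (simp add: unit_irrational_def)
      have "(\<lambda>n. farey_sum c n \<alpha>) \<longlonglongrightarrow> F \<alpha>" using elim \<alpha> by - (rule LIMSEQ_imp_Suc, simp)
      from filterlim_compose[OF this filterlim_cf_den_shift[OF irr]]
      have "(\<lambda>N. farey_sum c (nat (cf_den_shift \<alpha> (Suc (Suc N)))) \<alpha>) \<longlonglongrightarrow> F \<alpha>" .
      then show "(\<lambda>N. \<Sum>n=1..N. (-1) ^ (n - 1) * real_of_int (cf_den \<alpha> (int n - 1)) *
              (\<Sum>\<beta>\<in>semiconvergents \<alpha> n. c \<beta>)) \<longlonglongrightarrow> F \<alpha>"
        by (rule Lim_transform_eventually)
          \<comment> \<open>The identity starts at \<open>N = 1\<close>; at \<open>N = 0\<close> the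
            partial sum is empty.\<close>
          (rule eventually_mono[OF eventually_ge_at_top[of 1]], rule farey_sum_den[OF irr])
    qed
  qed
  ultimately show ?thesis by blast
qed

theorem theorem9:
  fixes c :: "rat \<Rightarrow> real"
  assumes "bounded ((\<lambda>Q. LBINT x:{0..<1}. \<bar>farey_sum c Q x\<bar>) ` {1..})"
  shows "\<exists>F :: real \<Rightarrow> real. set_integrable lborel {0..<1} F \<and>
    (AE \<alpha> in lborel. \<alpha> \<in> {0<..<1} \<and> \<alpha> \<notin> \<rat> \<longrightarrow>
      (\<lambda>N. \<Sum>n=1..N. (-1) ^ (n - 1) * real_of_int (cf_den \<alpha> (int n - 1)) *
              (\<Sum>\<beta>\<in>semiconvergents \<alpha> n. c \<beta>)) \<longlonglongrightarrow> F \<alpha>)"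
proof -
  obtain K where K: "\<And>Q. 1 \<le> Q \<Longrightarrow> \<bar>LBINT x:{0..<1}. \<bar>farey_sum c Q x\<bar>\<bar> \<le> K"
    using assms unfolding bounded_iff by auto
  show ?thesis by (rule semiconvergent_series_AE_convergent) (rule abs_le_D1[OF K])
qed

end
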